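(* Let $(\mathbf{x}_1,y_1),(\mathbf{x}_2,y_2),\ldots$ be i.i.d. copies of the pair $(\mathbf{x},y)$ following the two-group normal mixture model with parameters $\alpha_1\in(0,1)$, $\boldsymbol{\mu}_1\neq\boldsymbol{\mu}_2\in\mathbb{R}^p$ and full-rank covariance matrix $\boldsymbol{\Sigma}\in\mathbb{R}^{p\times p}$, and let $\mathbf{w}_n=\mathbf{S}_n^{-1}(\bar{\mathbf{x}}_{n2}-\bar{\mathbf{x}}_{n1})$ be the linear discriminant analysis estimator computed from $(\mathbf{x}_1,y_1),\ldots,(\mathbf{x}_n,y_n)$. Then, as $n\to\infty$, $$\sqrt{n}\left(\frac{\mathbf{w}_n}{\|\mathbf{w}_n\|}-\frac{\boldsymbol{\theta}}{\|\boldsymbol{\theta}\|}\right)\xrightarrow{d}\mathcal{N}_p(\mathbf{0},\boldsymbol{\Psi}_U),$$ where $$\boldsymbol{\Psi}_U:=\left(\frac{1+\beta\tau}{\|\boldsymbol{\theta}\|^2\beta}\right)\left(\mathbf{I}_p-\frac{\boldsymbol{\theta}\boldsymbol{\theta}'}{\|\boldsymbol{\theta}\|^2}\right)\boldsymbol{\Sigma}^{-1}\left(\mathbf{I}_p-\frac{\boldsymbol{\theta}\boldsymbol{\theta}'}{\|\boldsymbol{\theta}\|^2}\right),$$ $\boldsymbol{\theta}=\boldsymbol{\Sigma}^{-1}(\boldsymbol{\mu}_2-\boldsymbol{\mu}_1)$, $\beta:=\alpha_1\alpha_2$ with $\alpha_2=1-\alpha_1$, and $\tau:=(\boldsymbo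l{\mu}_2-\boldsymbol{\mu}_1)'\boldsymbol{\Sigma}^{-1}(\boldsymbol{\mu}_2-\boldsymbol{\mu}_1)$.
   Context: Two-group normal mixture model: $(\mathbf{x},y)$ takes values in $\mathbb{R}^p\times\{0,1\}$ with $y\sim\mathrm{Ber}(\alpha_1)$ and $\mathbf{x}\mid y\sim\mathcal{N}_p\{y\boldsymbol{\mu}_1+(1-y)\boldsymbol{\mu}_2,\boldsymbol{\Sigma}\}$. A prime denotes transpose, $\|\cdot\|$ is the Euclidean norm, and $\xrightarrow{d}$ is convergence in distribution. Estimator: $$\bar{\mathbf{x}}_{n1}:=\frac{\sum_{i=1}^n y_i\mathbf{x}_i}{\sum_{i=1}^n y_i},\qquad \bar{\mathbf{x}}_{n2}:=\frac{\sum_{i=1}^n(1-y_i)\mathbf{x}_i}{\sum_{i=1}^n(1-y_i)},$$ $$\mathbf{S}_n:=\frac{1}{n-2}\left\{\sum_{i=1}^n y_i(\mathbf{x}_i-\bar{\mathbf{x}}_{n1})(\mathbf{x}_i-\bar{\mathbf{x}}_{n1})'+\sum_{i=1}^n(1-y_i)(\mathbf{x}_i-\bar{\mathbf{x}}_{n2})(\mathbf{x}_i-\bar{\mathbf{x}}_{n2})'\right\},\qquad \mathbf{w}_n:=\mathbf{S}_n^{-1}(\bar{\mathbf{x}}_{n2}-\bar{\mathbf{x}}_{n1}).$$ On the event (of probability tending to zero) where $\mathbf{w}_n/\|\mathbf{w}_n\|$ is undefined it is given an arbitrary fixed value. *)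

theory Defs
  imports "HOL-Probability.Probability"
begin

section \<open>Multivariate normal distribution\<close>

definition std_mv_normal :: "(real ^ 'p) measure" where
  "std_mv_normal =
     distr (\<Pi>\<^sub>M i\<in>(UNIV :: 'p set). std_normal_distribution) borel (\<lambda>z. \<chi> i. z i)"

text \<open>
  The law of \<open>m + A z\<close> with \<open>z\<close> standard normal and \<open>A A' = V\<close>. This allows a singular \<open>V\<close>,
  for which there is no Lebesgue density. It is meaningful for symmetric positive semidefinite \<open>V\<close>
  only. The law does not depend on the choice of \<open>A\<close>, since its characteristic function
  involves \<open>m\<close> and \<open>V\<close> only, see \<open>char_mv_normal\<close> below.
\<close>
definition mv_normal :: "real ^ 'p \<Rightarrow> real ^ 'p ^ 'p \<Rightarrow> (real ^ 'p) measure" where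
  "mv_normal m V =
     distr std_mv_normal borel (\<lambda>z. m + (SOME A :: real ^ 'p ^ 'p. A ** transpose A = V) *v z)"

lemma measurable_vec_lambda_PiM:
  "(\<lambda>z. (\<chi> i. z i) :: real ^ 'p) \<in> borel_measurable (\<Pi>\<^sub>M i\<in>UNIV. std_normal_distribution)"
proof (subst borel_measurable_euclidean_space, intro ballI)
  fix b :: "real ^ 'p" assume "b \<in> Basis"
  then obtain j where "b = axis j 1" by (auto simp: Basis_vec_def)
  then have "(\<lambda>z. (\<chi> i. z i) \<bullet> b) = (\<lambda>z. z j)"
    by (simp add: inner_axis)
  moreover have "(\<lambda>z. z j) \<in> (\<Pi>\<^sub>M i\<in>(UNIV :: 'p set). std_normal_distribution) \<rightarrow>\<^sub>M std_normal_distribution"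
    by (rule measurable_component_singleton) simp
  ultimately show "(\<lambda>z. (\<chi> i. z i) \<bullet> b) \<in> borel_measurable (\<Pi>\<^sub>M i\<in>(UNIV :: 'p set). std_normal_distribution)"
    by simp
qed

lemma measurable_affine: "(\<lambda>z :: real ^ 'p. m + A *v z) \<in> borel_measurable borel"
  by (intro borel_measurable_continuous_onI continuous_intros)

lemma prob_space_std_mv_normal: "prob_space (std_mv_normal :: (real ^ 'p) measure)"
  unfolding std_mv_normal_def
  by (intro prob_space.prob_space_distr prob_space_PiM prob_space_normal_density
      measurable_vec_lambda_PiM) simp

lemma prob_space_mv_normal: "prob_space (mv_normal m V)"
  unfolding mv_normal_def
  by (intro prob_space.prob_space_distr[OF prob_space_std_mv_normal])
     (simp add: std_mv_normal_def measurable_affine)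

lemma char_std_mv_normal:
  fixes t :: "real ^ 'p"
  shows "(CLINT z|std_mv_normal. iexp (t \<bullet> z)) = exp (- (norm t)\<^sup>2 / 2)"
proof -
  interpret S: real_distribution std_normal_distribution
    by (rule real_dist_normal_dist)
  interpret product_sigma_finite "\<lambda>_ :: 'p. std_normal_distribution"
    by (intro product_sigma_finite.intro S.sigma_finite_measure_axioms)
  let ?P = "\<Pi>\<^sub>M i\<in>(UNIV :: 'p set). std_normal_distribution"
  have m: "(\<lambda>z :: real ^ 'p. iexp (t \<bullet> z)) \<in> borel_measurable borel"
    by (intro borel_measurable_continuous_onI continuous_intros)
  have "(CLINT z|std_mv_normal. iexp (t \<bullet> z)) = (CLINT z|?P. iexp (t \<bullet> (\<chi> i. z i)))"
    unfolding std_mv_normal_def by (rule integral_distr[OF measurable_vec_lambda_PiM m])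
  also have "\<dots> = (CLINT z|?P. (\<Prod>i\<in>UNIV. iexp (t $ i * z i)))"
    by (simp add: inner_vec_def sum_distrib_left exp_sum)
  also have "\<dots> = (\<Prod>i\<in>UNIV. CLINT x|std_normal_distribution. iexp (t $ i * x))"
    by (rule product_integral_prod) (auto intro!: S.integrable_iexp)
  also have "\<dots> = (\<Prod>i\<in>UNIV. complex_of_real (exp (- (t $ i)\<^sup>2 / 2)))"
    using char_std_normal_distribution unfolding char_def fun_eq_iff by (intro prod.cong) auto
  also have "\<dots> = complex_of_real (exp (\<Sum>i\<in>UNIV. - (t $ i)\<^sup>2 / 2))"
    by (simp add: exp_sum)
  also have "(\<Sum>i\<in>UNIV. - (t $ i)\<^sup>2 / 2) = - (norm t)\<^sup>2 / 2"
    unfolding power2_norm_eq_inner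
    by (simp add: inner_vec_def power2_eq_square sum_negf sum_divide_distrib)
  finally show ?thesis .
qed

lemma char_mv_normal:
  fixes t m :: "real ^ 'p" and B :: "real ^ 'p ^ 'p"
  assumes "B ** transpose B = V"
  shows "(CLINT x|mv_normal m V. iexp (t \<bullet> x)) = iexp (t \<bullet> m) * exp (- (t \<bullet> (V *v t)) / 2)"
proof -
  define A where "A = (SOME A :: real ^ 'p ^ 'p. A ** transpose A = V)"
  have A: "A ** transpose A = V" unfolding A_def using assms by (rule someI)
  have m: "(\<lambda>z :: real ^ 'p. iexp (t \<bullet> z)) \<in> borel_measurable borel"
    by (intro borel_measurable_continuous_onI continuous_intros)
  have aff: "(\<lambda>z. m + A *v z) \<in> std_mv_normal \<rightarrow>\<^sub>M borel"
    by (simp add: std_mv_normal_def measurable_affine)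
  have adj: "t \<bullet> (A *v z) = (transpose A *v t) \<bullet> z" for z
    by (simp add: dot_lmul_matrix)
  have "(CLINT x|mv_normal m V. iexp (t \<bullet> x)) = (CLINT z|std_mv_normal. iexp (t \<bullet> (m + A *v z)))"
    unfolding mv_normal_def A_def[symmetric] by (rule integral_distr[OF aff m])
  also have "\<dots> = (CLINT z|std_mv_normal. iexp (t \<bullet> m) * iexp ((transpose A *v t) \<bullet> z))"
    unfolding inner_add_right adj of_real_add distrib_left exp_add ..
  also have "\<dots> = iexp (t \<bullet> m) * exp (- (norm (transpose A *v t))\<^sup>2 / 2)"
    by (simp only: integral_mult_right_zero char_std_mv_normal)
  also have "(norm (transpose A *v t))\<^sup>2 = t \<bullet> (V *v t)"
    unfolding power2_norm_eq_inner A[symmetric] matrix_vector_mul_assoc[symmetric] adj ..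
  finally show ?thesis .
qed


section \<open>Convergence in distribution\<close>

definition converges_in_distribution ::
    "'a measure \<Rightarrow> (nat \<Rightarrow> 'a \<Rightarrow> 'b::topological_space) \<Rightarrow> 'b measure \<Rightarrow> bool" where
  "converges_in_distribution M Z L \<longleftrightarrow>
     (\<forall>n. Z n \<in> borel_measurable M) \<and>
     (\<forall>f :: 'b \<Rightarrow> real. continuous_on UNIV f \<and> bounded (range f) \<longrightarrow>
        (\<lambda>n. \<integral>\<omega>. f (Z n \<omega>) \<partial>M) \<longlonglongrightarrow> (\<integral>x. f x \<partial>L))"


section \<open>Two-group normal mixture model\<close>

definition two_group_normal_mixture ::
    "'a measure \<Rightarrow> ('a \<Rightarrow> real ^ 'p) \<Rightarrow> ('a \<Rightarrow> real) \<Rightarrow>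
     real \<Rightarrow> real ^ 'p \<Rightarrow> real ^ 'p \<Rightarrow> real ^ 'p ^ 'p \<Rightarrow> bool" where
  "two_group_normal_mixture M x y \<alpha>\<^sub>1 \<mu>\<^sub>1 \<mu>\<^sub>2 \<Sigma> \<longleftrightarrow>
     x \<in> borel_measurable M \<and> y \<in> borel_measurable M \<and>
     (\<forall>\<omega>\<in>space M. y \<omega> \<in> {0, 1}) \<and>
     distr M borel y = distr (measure_pmf (bernoulli_pmf \<alpha>\<^sub>1)) borel of_bool \<and>
     (\<forall>c\<in>{0, 1}. \<forall>B\<in>sets borel.
        \<P>(\<omega> in M. x \<omega> \<in> B \<bar> y \<omega> = c) = measure (mv_normal (c *\<^sub>R \<mu>\<^sub>1 + (1 - c) *\<^sub>R \<mu>\<^sub>2) \<Sigma>) B)"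

definition covariance_matrix :: "real ^ 'p ^ 'p \<Rightarrow> bool" where
  "covariance_matrix V \<longleftrightarrow> transpose V = V \<and> (\<forall>v. 0 \<le> v \<bullet> (V *v v))"

definition outer :: "real ^ 'p \<Rightarrow> real ^ 'p \<Rightarrow> real ^ 'p ^ 'p" where
  "outer u v = (\<chi> i j. u $ i * v $ j)"


section \<open>Linear discriminant analysis estimator\<close>

text \<open>The sample of size \<open>n\<close> consists of the pairs with indices \<open>0, \<dots>, n - 1\<close>.\<close>

definition group_mean1 :: "nat \<Rightarrow> (nat \<Rightarrow> real ^ 'p) \<Rightarrow> (nat \<Rightarrow> real) \<Rightarrow> real ^ 'p" where
  "group_mean1 n x y = (\<Sum>i<n. y i *\<^sub>R x i) /\<^sub>R (\<Sum>i<n. y i)"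

definition group_mean2 :: "nat \<Rightarrow> (nat \<Rightarrow> real ^ 'p) \<Rightarrow> (nat \<Rightarrow> real) \<Rightarrow> real ^ 'p" where
  "group_mean2 n x y = (\<Sum>i<n. (1 - y i) *\<^sub>R x i) /\<^sub>R (\<Sum>i<n. 1 - y i)"

definition pooled_cov :: "nat \<Rightarrow> (nat \<Rightarrow> real ^ 'p) \<Rightarrow> (nat \<Rightarrow> real) \<Rightarrow> real ^ 'p ^ 'p" where
  "pooled_cov n x y =
     (1 / (real n - 2)) *\<^sub>R
       ((\<Sum>i<n. y i *\<^sub>R outer (x i - group_mean1 n x y) (x i - group_mean1 n x y)) +
        (\<Sum>i<n. (1 - y i) *\<^sub>R outer (x i - group_mean2 n x y) (x i - group_mean2 n x y)))"

definition lda_w :: "nat \<Rightarrow> (nat \<Rightarrow> real ^ 'p) \<Rightarrow> (nat \<Rightarrow> real) \<Rightarrow> real ^ 'p" where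
  "lda_w n x y = matrix_inv (pooled_cov n x y) *v (group_mean2 n x y - group_mean1 n x y)"

text \<open>
  Division by zero and \<open>matrix_inv\<close> of a singular matrix are total in HOL, so we state explicitly
  when \<open>lda_w n x y\<close> and its normalisation are mathematically defined.
\<close>
definition lda_direction_defined :: "nat \<Rightarrow> (nat \<Rightarrow> real ^ 'p) \<Rightarrow> (nat \<Rightarrow> real) \<Rightarrow> bool" where
  "lda_direction_defined n x y \<longleftrightarrow>
     (\<Sum>i<n. y i) \<noteq> 0 \<and> (\<Sum>i<n. 1 - y i) \<noteq> 0 \<and> real n - 2 \<noteq> 0 \<and>
     invertible (pooled_cov n x y) \<and> lda_w n x y \<noteq> 0"

definition lda_direction ::
    "real ^ 'p \<Rightarrow> nat \<Rightarrow> (nat \<Rightarrow> real ^ 'p) \<Rightarrow> (nat \<Rightarrow> real) \<Rightarrow> real ^ 'p" where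
  "lda_direction d\<^sub>0 n x y =
     (if lda_direction_defined n x y then lda_w n x y /\<^sub>R norm (lda_w n x y) else d\<^sub>0)"

end

theory Submission
  imports Defs
begin

text \<open>
  Let \<open>\<epsilon>\<close> denote \<open>x\<close> minus the mean of its group; it is independent of \<open>y\<close> with law \<open>N(0, \<Sigma>)\<close>.
  The factor \<open>n / (n - 2)\<close> in \<open>S\<^sub>n\<close> does not affect the direction of \<open>w\<^sub>n\<close>, so for \<open>n \<ge> 3\<close> the
  direction is a fixed function of the averages of \<open>(y, y \<epsilon>, (1 - y) \<epsilon>, \<epsilon> \<epsilon>')\<close>. The theorem
  is the delta method at \<open>(\<alpha>\<^sub>1, 0, 0, \<Sigma>)\<close>. The derivative there factors through the projection that
  annihilates \<open>\<theta>\<close>, so only linear forms \<open>u\<close> with \<open>u' \<Sigma> \<theta> = 0\<close> enter the asymptotic variance. For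
  these \<open>u' \<epsilon>\<close> and \<open>\<theta>' \<epsilon>\<close> are uncorrelated, and the variance of
  \<open>((1 - y) / \<alpha>\<^sub>2 - y / \<alpha>\<^sub>1) u' \<epsilon> - (\<theta>' \<epsilon>) (u' \<epsilon>)\<close> is \<open>(1 / \<beta> + \<tau>) u' \<Sigma> u\<close>.
\<close>

section \<open>Positive definite matrices\<close>

text \<open>The limit law is singular, since \<open>\<Psi>\<^sub>U\<close> annihilates
  \<open>\<theta>\<close>. It has no density, so convergence is proved through characteristic
  functions, and the one-dimensional limit theorem has to cover variance zero. Because
  \<open>mv_normal\<close> picks its factor by \<open>SOME\<close>, a factor of
  \<open>\<Psi>\<^sub>U\<close> must be exhibited; it is built from a factor of the inverse of
  \<open>\<Sigma>\<close>. Centring at the group means puts the base point at b = c = 0. There each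
  term of d(T) - S(T) \<theta> that involves the proportion a carries a vanishing factor b or c, so
  fluctuations of a leave no trace in the derivative. The inverse matrix is never differentiated:
  continuity of Cramer's rule is enough. In the constant, the weight (1 - y) / \<alpha>2 - y /
  \<alpha>1 has mean 0 and second moment 1 / \<alpha>1 + 1 / \<alpha>2 = 1 / \<beta>. The quadratic
  term contributes \<tau> because the mixed fourth moment factorises for V-orthogonal forms. The
  norm of \<theta> enters through the normalisation of w.\<close>

lemma psd_full_rank_imp_pos_def:
  fixes V :: "real ^ 'p ^ 'p"
  assumes "covariance_matrix V" and "rank V = CARD('p)" and "v \<noteq> 0"
  shows "0 < v \<bullet> (V *v v)"
proof (rule ccontr)
  assume "\<not> ?thesis"
  with assms(1) have z: "v \<bullet> (V *v v) = 0"
    by (metis covariance_matrix_def order_le_less)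
  have sym: "a \<bullet> (V *v b) = (V *v a) \<bullet> b" for a b
    using assms(1) by (metis covariance_matrix_def dot_lmul_matrix vector_transpose_matrix)
  define w where "w = V *v v"
  have "w \<noteq> 0"
    using assms(2,3) unfolding w_def
    by (metis full_rank_injective injD matrix_vector_mult_0_right)
  then have pos: "0 < w \<bullet> w" by simp
  define c where "c = w \<bullet> (V *v w)"
  have "0 \<le> c" using assms(1) by (simp add: c_def covariance_matrix_def)
  \<comment> \<open>From v, a move along w = V v changes the quadratic form by 2 t (w.w) + t^2 c.
    The first-order term wins for small negative t. The minimiser is -(w.w) / c; using c + 1 avoids
    a zero denominator and still gives a negative value.\<close>
  define t where "t = - (w \<bullet> w) / (c + 1)"
  have "0 \<le> (v + t *\<^sub>R w) \<bullet> (V *v (v + t *\<^sub>R w))"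
    using assms(1) by (simp add: covariance_matrix_def)
  also have "\<dots> = 2 * t * (w \<bullet> w) + t\<^sup>2 * c"
    using z sym[of v w]
    by (simp add: matrix_vector_right_distrib matrix_vector_mult_scaleR inner_add_left
        inner_add_right c_def w_def[symmetric] power2_eq_square inner_commute algebra_simps)
  also have "\<dots> = (w \<bullet> w)\<^sup>2 * (c / (c + 1) - 2) / (c + 1)"
    using \<open>0 \<le> c\<close> by (simp add: t_def power2_eq_square divide_simps) (simp add: algebra_simps)
  also have "\<dots> < 0"
  proof -
    have "c / (c + 1) - 2 < 0" using \<open>0 \<le> c\<close> by (simp add: divide_simps)
    then show ?thesis using pos \<open>0 \<le> c\<close>
      by (simp add: divide_neg_pos mult_pos_neg)
  qed
  finally show False by simp
qed

text \<open>Gram-Schmidt for the inner product a' V b, in dual form: as long as k < p, some nonzero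
  vector is orthogonal in the Euclidean sense to all \<open>V *v f i\<close>, and it only remains to
  rescale it.\<close>

lemma orthonormal_family_wrt:
  fixes V :: "real ^ 'p ^ 'p"
  assumes sym: "transpose V = V" and pd: "\<And>v. v \<noteq> 0 \<Longrightarrow> 0 < v \<bullet> (V *v v)"
  shows "k \<le> CARD('p) \<Longrightarrow>
    \<exists>f :: nat \<Rightarrow> real ^ 'p. \<forall>i<k. \<forall>j<k. f i \<bullet> (V *v f j) = (if i = j then 1 else 0)"
proof (induction k)
  case 0
  then show ?case by simp
next
  case (Suc k)
  then obtain f :: "nat \<Rightarrow> real ^ 'p"
    where f: "\<And>i j. i < k \<Longrightarrow> j < k \<Longrightarrow> f i \<bullet> (V *v f j) = (if i = j then 1 else 0)"
    by auto
  have sym': "a \<bullet> (V *v b) = b \<bullet> (V *v a)" for a b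
    using sym by (metis dot_lmul_matrix vector_transpose_matrix inner_commute)
  have "dim ((\<lambda>i. V *v f i) ` {..<k}) \<le> card ((\<lambda>i. V *v f i) ` {..<k})"
    by (rule dim_le_card') simp
  also have "\<dots> \<le> k" using card_image_le[of "{..<k}"] by simp
  also have "\<dots> < DIM(real ^ 'p)" using Suc.prems by simp
  finally obtain v where v: "v \<noteq> 0" "\<And>y. y \<in> span ((\<lambda>i. V *v f i) ` {..<k}) \<Longrightarrow> orthogonal v y"
    using orthogonal_to_subspace_exists by blast
  define c where "c = sqrt (v \<bullet> (V *v v))"
  have c: "c > 0" "c * c = v \<bullet> (V *v v)" using pd[OF v(1)] by (auto simp: c_def)
  define u where "u = v /\<^sub>R c"
  have uu: "u \<bullet> (V *v u) = 1"
    using c by (simp add: u_def matrix_vector_mult_scaleR c(2)[symmetric] field_simps)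
  have uf: "u \<bullet> (V *v f i) = 0" if "i < k" for i
    using v(2)[of "V *v f i"] that by (auto simp: u_def orthogonal_def intro: span_base)
  have fu: "f i \<bullet> (V *v u) = 0" if "i < k" for i
    using uf[OF that] sym'[of "f i" u] by simp
  show ?case
    by (rule exI[of _ "f(k := u)"]) (auto simp: less_Suc_eq f uu uf fu)
qed

text \<open>Let the rows of B be V-orthonormal, so that B V B' = I. Then C = V B' is inverse to B,
  its transpose is B V, and C C' = C B V = V. Such a factor is what gives \<open>mv_normal\<close>
  its meaning.\<close>

lemma pos_def_factorization:
  fixes V :: "real ^ 'p ^ 'p"
  assumes sym: "transpose V = V" and pd: "\<And>v. v \<noteq> 0 \<Longrightarrow> 0 < v \<bullet> (V *v v)"
  shows "\<exists>A :: real ^ 'p ^ 'p. A ** transpose A = V"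
proof -
  obtain f :: "nat \<Rightarrow> real ^ 'p"
    where f: "\<And>i j. i < CARD('p) \<Longrightarrow> j < CARD('p) \<Longrightarrow> f i \<bullet> (V *v f j) = (if i = j then 1 else 0)"
    using orthonormal_family_wrt[OF assms, of "CARD('p)"] by auto
  obtain h :: "'p \<Rightarrow> nat" where h: "bij_betw h UNIV {..<CARD('p)}"
    using ex_bij_betw_finite_nat[of "UNIV :: 'p set"] by (auto simp: atLeast0LessThan)
  have hlt: "h i < CARD('p)" for i using h by (auto simp: bij_betw_def)
  have hinj: "h i = h j \<longleftrightarrow> i = j" for i j using h by (auto simp: bij_betw_def inj_on_def)
  define B :: "real ^ 'p ^ 'p" where "B = (\<chi> i. f (h i))"
  have "(B ** V ** transpose B) $ i $ j = f (h i) \<bullet> (V *v f (h j))" for i j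
  proof -
    have entry: "(P ** Q) $ i $ j = (\<Sum>k\<in>UNIV. P $ i $ k * Q $ k $ j)" for P Q :: "real ^ 'p ^ 'p"
      by (simp add: matrix_matrix_mult_def)
    have VB: "(V ** transpose B) $ k $ j = (V *v f (h j)) $ k" for k
      by (simp add: matrix_matrix_mult_def matrix_vector_mult_def B_def transpose_def)
    have "(B ** (V ** transpose B)) $ i $ j = (\<Sum>k\<in>UNIV. f (h i) $ k * (V ** transpose B) $ k $ j)"
      by (simp add: entry) (simp add: B_def)
    also have "\<dots> = (\<Sum>k\<in>UNIV. f (h i) $ k * (V *v f (h j)) $ k)"
      by (simp only: VB)
    finally show ?thesis by (simp add: inner_vec_def matrix_mul_assoc)
  qed
  then have BVB: "B ** V ** transpose B = mat 1"
    by (simp add: vec_eq_iff f hlt hinj mat_def)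
  define C where "C = V ** transpose B"
  have "B ** C = mat 1" using BVB by (simp add: C_def matrix_mul_assoc)
  then have CB: "C ** B = mat 1" by (simp add: matrix_left_right_inverse)
  have tC: "transpose C = B ** V"
    by (simp add: C_def matrix_transpose_mul sym)
  have "C ** transpose C = V" by (simp add: tC matrix_mul_assoc CB)
  then show ?thesis ..
qed

section \<open>Levy's continuity theorem in several dimensions\<close>

text \<open>Integrals of these functions are finite combinations of values of the characteristic
  function, so convergence of characteristic functions carries over to them. Arbitrary real
  frequencies are allowed in order to have sin (c x_k) at every scale c.\<close>

inductive trig_poly :: "(real ^ 'p \<Rightarrow> complex) \<Rightarrow> bool" where
  monom: "trig_poly (\<lambda>x. c * iexp (t \<bullet> x))"
| add: "trig_poly f \<Longrightarrow> trig_poly g \<Longrightarrow> trig_poly (\<lambda>x. f x + g x)"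

lemma trig_poly_const: "trig_poly (\<lambda>x. c)"
  using trig_poly.monom[of c 0] by simp

lemma trig_poly_mult_monom: "trig_poly f \<Longrightarrow> trig_poly (\<lambda>x. c * iexp (t \<bullet> x) * f x)"
proof (induction rule: trig_poly.induct)
  case (monom d s)
  have "(\<lambda>x. c * iexp (t \<bullet> x) * (d * iexp (s \<bullet> x))) = (\<lambda>x. (c * d) * iexp ((t + s) \<bullet> x))"
    by (simp add: inner_add_left distrib_left exp_add fun_eq_iff ac_simps)
  then show ?case using trig_poly.monom[of "c * d" "t + s"] by simp
next
  case (add f g)
  then show ?case unfolding distrib_left by (intro trig_poly.add)
qed

lemma trig_poly_mult: "trig_poly f \<Longrightarrow> trig_poly g \<Longrightarrow> trig_poly (\<lambda>x. f x * g x)"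
proof (induction rule: trig_poly.induct)
  case (monom c t)
  then show ?case by (rule trig_poly_mult_monom)
next
  case (add f h)
  then show ?case unfolding distrib_right by (intro trig_poly.add) auto
qed

lemma trig_poly_sum: "(\<And>i. i \<in> I \<Longrightarrow> trig_poly (f i)) \<Longrightarrow> trig_poly (\<lambda>x. \<Sum>i\<in>I. f i x)"
proof (induction I rule: infinite_finite_induct)
  case (insert i I)
  then show ?case by (simp add: trig_poly.add)
qed (simp_all add: trig_poly_const)

lemma trig_poly_sin: "trig_poly (\<lambda>x :: real ^ 'p. complex_of_real (sin (c * x $ k)))"
proof -
  have "(\<lambda>x. complex_of_real (sin (c * x $ k))) =
    (\<lambda>x :: real ^ 'p. (- \<i> / 2) * iexp (axis k c \<bullet> x) + (\<i> / 2) * iexp (axis k (- c) \<bullet> x))"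
    by (simp only: cis_conv_exp[symmetric] inner_axis') (simp add: fun_eq_iff complex_eq_iff)
  moreover have "trig_poly \<dots>" by (intro trig_poly.add trig_poly.monom)
  ultimately show ?thesis by simp
qed

lemma trig_poly_continuous: "trig_poly f \<Longrightarrow> continuous_on UNIV f"
  by (induction rule: trig_poly.induct) (auto intro!: continuous_intros)

lemma trig_poly_bounded: "trig_poly f \<Longrightarrow> \<exists>B. \<forall>x. cmod (f x) \<le> B"
proof (induction rule: trig_poly.induct)
  case (monom c t)
  then show ?case by (auto simp: norm_mult)
next
  case (add f g)
  then obtain B C where "\<forall>x. cmod (f x) \<le> B" "\<forall>x. cmod (g x) \<le> C" by auto
  then have "\<forall>x. cmod (f x + g x) \<le> B + C" by (meson add_mono norm_triangle_le)
  then show ?case ..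
qed

lemma trig_poly_polynomial_sin:
  assumes "real_polynomial_function q"
  shows "trig_poly (\<lambda>x :: real ^ 'p. complex_of_real (q (\<chi> k. sin (c * x $ k))))"
  using assms
proof (induction rule: real_polynomial_function.induct)
  case (linear f)
  interpret bounded_linear f by fact
  have eq: "f v = (\<Sum>k\<in>UNIV. v $ k * f (axis k 1))" for v :: "real ^ 'p"
  proof -
    have "f v = f (\<Sum>k\<in>UNIV. v $ k *\<^sub>R axis k 1)"
      using basis_expansion[of v] by (simp add: scalar_mult_eq_scaleR)
    then show ?thesis by (simp add: sum scaleR)
  qed
  have "trig_poly (\<lambda>x :: real ^ 'p. complex_of_real (f (axis k 1)) * complex_of_real (sin (c * x $ k)))" for k
    by (intro trig_poly_mult trig_poly_const trig_poly_sin)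
  from trig_poly_sum[of UNIV, OF this] show ?case
    by (subst eq) (simp add: mult.commute)
next
  case (const c)
  then show ?case by (rule trig_poly_const)
next
  case (add f g)
  then show ?case by (simp add: trig_poly.add)
next
  case (mult f g)
  then show ?case by (simp add: trig_poly_mult)
qed

lemma (in finite_measure) trig_poly_integrable:
  assumes [measurable]: "Z \<in> borel_measurable M" and f: "trig_poly f"
  shows "integrable M (\<lambda>\<omega>. f (Z \<omega>))"
proof -
  obtain B where "\<forall>x. cmod (f x) \<le> B" using trig_poly_bounded[OF f] ..
  moreover have [measurable]: "f \<in> borel_measurable borel"
    using trig_poly_continuous[OF f] by (rule borel_measurable_continuous_onI)
  ultimately show ?thesis by (intro integrable_const_bound[of _ B]) auto
qed

lemma trig_poly_integral_tendsto:
  fixes Z :: "nat \<Rightarrow> 'a \<Rightarrow> real ^ 'p" and L :: "(real ^ 'p) measure"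
  assumes "prob_space M" and Z: "\<And>n. Z n \<in> borel_measurable M"
    and "prob_space L" and L: "sets L = sets borel"
    and char: "\<And>t. (\<lambda>n. CLINT \<omega>|M. iexp (t \<bullet> Z n \<omega>)) \<longlonglongrightarrow> (CLINT x|L. iexp (t \<bullet> x))"
    and f: "trig_poly f"
  shows "(\<lambda>n. CLINT \<omega>|M. f (Z n \<omega>)) \<longlonglongrightarrow> (CLINT x|L. f x)"
proof -
  interpret M: prob_space M by fact
  interpret L: prob_space L by fact
  have id: "(\<lambda>x. x) \<in> borel_measurable L" using L by (simp add: measurable_ident_sets)
  show ?thesis
    using f
  proof induction
    case (monom c t)
    then show ?case using tendsto_mult_left[OF char, of c] by simp
  next
    case (add f g)
    then show ?case
      using M.trig_poly_integrable[OF Z] L.trig_poly_integrable[OF id]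
      by (simp add: tendsto_add)
  qed
qed

text \<open>
  On the cube \<open>|c x\<^sub>k| \<le> \<pi>/2\<close> one has \<open>arcsin (sin (c x\<^sub>k)) = c x\<^sub>k\<close>, so a polynomial that is close to
  \<open>s \<mapsto> f (arcsin s / c)\<close> on \<open>[-1, 1]\<^sup>p\<close> yields, composed with \<open>sin (c x\<^sub>k)\<close>, a trigonometric polynomial
  that is close to \<open>f\<close> on the cube and globally bounded.
\<close>
lemma trig_poly_approx:
  fixes f :: "real ^ 'p \<Rightarrow> real"
  assumes f: "continuous_on UNIV f" and B: "\<And>x. \<bar>f x\<bar> \<le> B" and "0 < e" and "0 < K"
  obtains q where "trig_poly (\<lambda>x. complex_of_real (q x))" "\<And>x. \<bar>q x\<bar> \<le> B + e"
    "\<And>x. norm x \<le> K \<Longrightarrow> \<bar>q x - f x\<bar> \<le> e"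
proof -
  define c where "c = pi / 2 / K"
  have c: "c > 0" using \<open>0 < K\<close> by (simp add: c_def)
  define S :: "(real ^ 'p) set" where "S = cbox (\<chi> i. -1) (\<chi> i. 1)"
  have S: "s \<in> S \<longleftrightarrow> (\<forall>k. -1 \<le> s $ k \<and> s $ k \<le> 1)" for s
    by (simp add: S_def mem_box_cart)
  define h where "h s = f (\<chi> k. arcsin (s $ k) / c)" for s :: "real ^ 'p"
  have "continuous_on S h"
    unfolding h_def
    by (rule continuous_on_compose2[OF f])
       (auto intro!: continuous_on_vec_lambda continuous_on_divide continuous_on_arcsin continuous_intros
         simp: S c[THEN less_imp_neq, symmetric])
  moreover have "compact S" by (simp add: S_def compact_cbox)
  ultimately obtain r where r: "real_polynomial_function r" "\<And>s. s \<in> S \<Longrightarrow> \<bar>h s - r s\<bar> < e"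
    using Stone_Weierstrass_real_polynomial_function[of S h e] \<open>0 < e\<close> by blast
  define q where "q x = r (\<chi> k. sin (c * x $ k))" for x :: "real ^ 'p"
  have sinS: "(\<chi> k. sin (c * x $ k)) \<in> S" for x :: "real ^ 'p" by (simp add: S)
  show thesis
  proof
    show "trig_poly (\<lambda>x. complex_of_real (q x))"
      unfolding q_def using r(1) by (rule trig_poly_polynomial_sin)
    show "\<bar>q x\<bar> \<le> B + e" for x
      using r(2)[OF sinS[of x]] B[of "\<chi> k. arcsin ((\<chi> k. sin (c * x $ k)) $ k) / c"]
      unfolding q_def h_def by linarith
    show "\<bar>q x - f x\<bar> \<le> e" if "norm x \<le> K" for x
    proof -
      have "arcsin (sin (c * x $ k)) = c * x $ k" for k
      proof (rule arcsin_sin)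
        have "\<bar>x $ k\<bar> \<le> K" using component_le_norm_cart[of x k] that by linarith
        then have "\<bar>c * x $ k\<bar> \<le> c * K" using c by (simp add: abs_mult)
        then have "\<bar>c * x $ k\<bar> \<le> pi / 2" using \<open>0 < K\<close> by (simp add: c_def)
        then show "- (pi / 2) \<le> c * x $ k" "c * x $ k \<le> pi / 2" by linarith+
      qed
      then have "h (\<chi> k. sin (c * x $ k)) = f x"
        using c by (simp add: h_def)
      with r(2)[OF sinS[of x]] show ?thesis by (simp add: q_def)
    qed
  qed
qed

text \<open>Continuity from above along events with empty intersection; this is the tightness of a
  single law.\<close>

lemma (in finite_measure) tail_measure_tendsto_0:
  fixes Z :: "'a \<Rightarrow> 'b :: real_normed_vector"
  assumes [measurable]: "Z \<in> borel_measurable M"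
  shows "(\<lambda>n. measure M {\<omega> \<in> space M. real n < norm (Z \<omega>)}) \<longlonglongrightarrow> 0"
proof -
  have "(\<lambda>n. measure M {\<omega> \<in> space M. real n < norm (Z \<omega>)}) \<longlonglongrightarrow>
      measure M (\<Inter>n. {\<omega> \<in> space M. real n < norm (Z \<omega>)})"
    by (intro finite_Lim_measure_decseq) (auto simp: decseq_def)
  moreover have "(\<Inter>n. {\<omega> \<in> space M. real n < norm (Z \<omega>)}) = {}"
    using reals_Archimedean2 not_less_iff_gr_or_eq by fastforce
  ultimately show ?thesis by simp
qed

text \<open>The integrand is at most e where Z stays in the ball of radius K, and at most B + C
  elsewhere. The estimate serves both the sequence and its limit, so Z is left general.\<close>

lemma (in prob_space) integral_diff_le_tail:
  fixes f q :: "'b :: real_normed_vector \<Rightarrow> real"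
  assumes [measurable]: "Z \<in> borel_measurable M" "f \<in> borel_measurable borel" "q \<in> borel_measurable borel"
    and f: "\<And>x. \<bar>f x\<bar> \<le> B" and q: "\<And>x. \<bar>q x\<bar> \<le> C" and fq: "\<And>x. norm x \<le> K \<Longrightarrow> \<bar>q x - f x\<bar> \<le> e"
    and "0 \<le> e"
  shows "\<bar>(\<integral>\<omega>. q (Z \<omega>) \<partial>M) - (\<integral>\<omega>. f (Z \<omega>) \<partial>M)\<bar> \<le> e + (B + C) * prob {\<omega> \<in> space M. K < norm (Z \<omega>)}"
proof -
  have [simp]: "integrable M (\<lambda>\<omega>. q (Z \<omega>))" "integrable M (\<lambda>\<omega>. f (Z \<omega>))"
    using f q by (intro integrable_const_bound[where B = C]; simp)
      (use f in \<open>intro integrable_const_bound[where B = B]; simp\<close>)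
  let ?A = "{\<omega> \<in> space M. K < norm (Z \<omega>)}"
  have "\<bar>(\<integral>\<omega>. q (Z \<omega>) \<partial>M) - (\<integral>\<omega>. f (Z \<omega>) \<partial>M)\<bar> \<le> (\<integral>\<omega>. \<bar>q (Z \<omega>) - f (Z \<omega>)\<bar> \<partial>M)"
    using integral_abs_bound[of M "\<lambda>\<omega>. q (Z \<omega>) - f (Z \<omega>)"] by simp
  also have "\<dots> \<le> (\<integral>\<omega>. e + (B + C) * indicator ?A \<omega> \<partial>M)"
  proof (rule integral_mono)
    show "\<bar>q (Z \<omega>) - f (Z \<omega>)\<bar> \<le> e + (B + C) * indicator ?A \<omega>" if "\<omega> \<in> space M" for \<omega>
      using fq[of "Z \<omega>"] f[of "Z \<omega>"] q[of "Z \<omega>"] \<open>0 \<le> e\<close> that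
      by (cases "norm (Z \<omega>) \<le> K") (auto split: split_indicator)
  qed (auto intro!: integrable_real_indicator simp: emeasure_eq_measure)
  also have "\<dots> = e + (B + C) * prob ?A"
    by (simp add: prob_space emeasure_eq_measure)
  finally show ?thesis .
qed

text \<open>A test function is replaced by a trigonometric polynomial that is close to it on a large
  ball and bounded everywhere. Characteristic functions handle the polynomial, tightness the
  complement of the ball. Tightness is a hypothesis because second moments supply it directly in the
  application.\<close>

theorem levy_continuity_mv:
  fixes Z :: "nat \<Rightarrow> 'a \<Rightarrow> real ^ 'p" and L :: "(real ^ 'p) measure"
  assumes "prob_space M" and Z: "\<And>n. Z n \<in> borel_measurable M"
    and "prob_space L" and L: "sets L = sets borel"
    and char: "\<And>t. (\<lambda>n. CLINT \<omega>|M. iexp (t \<bullet> Z n \<omega>)) \<longlonglongrightarrow> (CLINT x|L. iexp (t \<bullet> x))"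
    and tight: "\<And>e. 0 < e \<Longrightarrow>
      \<exists>K. \<forall>\<^sub>F n in sequentially. measure M {\<omega> \<in> space M. K < norm (Z n \<omega>)} \<le> e"
  shows "converges_in_distribution M Z L"
  unfolding converges_in_distribution_def
proof (intro conjI allI impI)
  fix f :: "real ^ 'p \<Rightarrow> real"
  assume "continuous_on UNIV f \<and> bounded (range f)"
  then have f: "continuous_on UNIV f" and "bounded (range f)" by auto
  then obtain B where B: "\<And>x. \<bar>f x\<bar> \<le> B" by (auto simp: bounded_iff)
  interpret M: prob_space M by fact
  interpret L: prob_space L by fact
  have [measurable]: "(\<lambda>x. x) \<in> borel_measurable L" using L by (simp add: measurable_ident_sets)
  note [measurable] = Z borel_measurable_continuous_onI[OF f]
  have "B \<ge> 0" using B[of 0] by linarith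
  show "(\<lambda>n. \<integral>\<omega>. f (Z n \<omega>) \<partial>M) \<longlonglongrightarrow> (\<integral>x. f x \<partial>L)"
  proof (rule LIMSEQ_I)
    fix r :: real assume "0 < r"
    \<comment> \<open>Error budget: replacing f by q costs at most e (2 B + 2) under each of the two
      laws, and the convergence for q costs e, in total less than e (4 B + 8). The cap e \<le> 1
      turns the tail factor 2 B + e into 2 B + 1.\<close>
    define e where "e = min 1 (r / (4 * B + 8))"
    have e: "0 < e" "e \<le> 1" "e * (4 * B + 8) \<le> r"
    proof -
      show "0 < e" "e \<le> 1" using \<open>0 < r\<close> \<open>0 \<le> B\<close> by (auto simp: e_def)
      have "e \<le> r / (4 * B + 8)" by (simp add: e_def)
      then show "e * (4 * B + 8) \<le> r" using \<open>0 \<le> B\<close> by (simp add: pos_le_divide_eq)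
    qed
    obtain K1 where K1: "\<forall>\<^sub>F n in sequentially. M.prob {\<omega> \<in> space M. K1 < norm (Z n \<omega>)} \<le> e"
      using tight[OF e(1)] by blast
    have "\<forall>\<^sub>F n in sequentially. L.prob {x \<in> space L. real n < norm x} < e"
      using L.tail_measure_tendsto_0[of "\<lambda>x. x"] e(1) by (auto intro: order_tendstoD)
    then obtain K2 where K2: "L.prob {x \<in> space L. real K2 < norm x} < e"
      by (auto simp: eventually_sequentially)
    \<comment> \<open>One radius beyond both thresholds, so that the same q works for all large n
      and for L; the 1 keeps it positive.\<close>
    define K where "K = max 1 (max K1 (real K2))"
    have "K > 0" by (simp add: K_def)
    obtain q where q: "trig_poly (\<lambda>x. complex_of_real (q x))" "\<And>x. \<bar>q x\<bar> \<le> B + e"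
      "\<And>x. norm x \<le> K \<Longrightarrow> \<bar>q x - f x\<bar> \<le> e"
      using trig_poly_approx[OF f B e(1) \<open>K > 0\<close>] by blast
    have [measurable]: "q \<in> borel_measurable borel"
    proof -
      have "(\<lambda>x. Re (complex_of_real (q x))) \<in> borel_measurable borel"
        by (intro borel_measurable_continuous_onI continuous_intros trig_poly_continuous[OF q(1)])
      then show ?thesis by simp
    qed
    have conv: "(\<lambda>n. \<integral>\<omega>. q (Z n \<omega>) \<partial>M) \<longlonglongrightarrow> (\<integral>x. q x \<partial>L)"
      using trig_poly_integral_tendsto[OF assms(1-5) q(1)]
      by (simp add: integral_complex_of_real tendsto_of_real_iff)
    have ev: "\<forall>\<^sub>F n in sequentially. \<bar>(\<integral>\<omega>. q (Z n \<omega>) \<partial>M) - (\<integral>x. q x \<partial>L)\<bar> < e"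
      using tendstoD[OF conv e(1)] by (simp add: dist_real_def)
    have tail: "e + (B + (B + e)) * p \<le> e * (2 * B + 2)" if "p \<le> e" "0 \<le> p" for p
    proof -
      have "(B + (B + e)) * p \<le> (2 * B + 1) * e"
        using that \<open>0 \<le> B\<close> e by (intro mult_mono) auto
      then show ?thesis by (simp add: algebra_simps)
    qed
    have dL: "\<bar>(\<integral>x. q x \<partial>L) - (\<integral>x. f x \<partial>L)\<bar> \<le> e * (2 * B + 2)"
    proof -
      have "L.prob {x \<in> space L. K < norm x} \<le> L.prob {x \<in> space L. real K2 < norm x}"
        by (intro L.finite_measure_mono) (auto simp: K_def)
      then have "e + (B + (B + e)) * L.prob {x \<in> space L. K < norm x} \<le> e * (2 * B + 2)"
        using K2 by (intro tail) auto
      then show ?thesis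
        using L.integral_diff_le_tail[of "\<lambda>x. x" f q B "B + e" K e] B q(2,3) e(1) by auto
    qed
    from ev K1 have "\<forall>\<^sub>F n in sequentially. \<bar>(\<integral>\<omega>. f (Z n \<omega>) \<partial>M) - (\<integral>x. f x \<partial>L)\<bar> < r"
    proof eventually_elim
      case (elim n)
      have "M.prob {\<omega> \<in> space M. K < norm (Z n \<omega>)} \<le> M.prob {\<omega> \<in> space M. K1 < norm (Z n \<omega>)}"
        by (intro M.finite_measure_mono) (auto simp: K_def)
      then have "e + (B + (B + e)) * M.prob {\<omega> \<in> space M. K < norm (Z n \<omega>)} \<le> e * (2 * B + 2)"
        using elim by (intro tail) auto
      then have "\<bar>(\<integral>\<omega>. q (Z n \<omega>) \<partial>M) - (\<integral>\<omega>. f (Z n \<omega>) \<partial>M)\<bar> \<le> e * (2 * B + 2)"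
        using M.integral_diff_le_tail[of "Z n" f q B "B + e" K e] B q(2,3) e(1) by auto
      then have "\<bar>(\<integral>\<omega>. f (Z n \<omega>) \<partial>M) - (\<integral>x. f x \<partial>L)\<bar> < e * (2 * B + 2) + e * (2 * B + 2) + e"
        using dL elim(1) by linarith
      also have "\<dots> \<le> e * (4 * B + 8)" using e(1) by (simp add: algebra_simps)
      finally show ?case using e(3) by linarith
    qed
    then show "\<exists>N. \<forall>n\<ge>N. norm ((\<integral>\<omega>. f (Z n \<omega>) \<partial>M) - (\<integral>x. f x \<partial>L)) < r"
      by (auto simp: eventually_sequentially)
  qed
qed (rule Z)

section \<open>Central limit theorem and delta method\<close>

lemma cmod_iexp_diff_le: "cmod (iexp a - iexp b) \<le> \<bar>a - b\<bar>"
proof -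
  have "iexp a - iexp b = iexp b * (iexp (a - b) - 1)"
    by (simp add: exp_diff algebra_simps)
  then have "cmod (iexp a - iexp b) = cmod (iexp (a - b) - 1)"
    by (simp add: norm_mult)
  also have "\<dots> \<le> \<bar>a - b\<bar>" using iexp_approx1[of "a - b" 0] by simp
  finally show ?thesis .
qed

lemma norm_le_norm_one_plus_square: "norm x \<le> norm (1 + (norm x)\<^sup>2)"
  for x :: "'a :: real_normed_vector"
proof -
  have "2 * norm x \<le> (norm x)\<^sup>2 + 1" using sum_squares_bound[of "norm x" 1] by simp
  then have "norm x \<le> 1 + (norm x)\<^sup>2" using norm_ge_zero[of x] by linarith
  then show ?thesis by simp
qed

text \<open>Each new summand is centred and independent of the partial sum, so the cross term
  vanishes. The result settles the case of variance zero in the limit theorem and gives tightness in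
  the delta method.\<close>

lemma (in prob_space) indep_sum_second_moment:
  fixes X :: "nat \<Rightarrow> 'a \<Rightarrow> real"
  assumes indep: "indep_vars (\<lambda>_. borel) X UNIV"
    and sq: "\<And>i. integrable M (\<lambda>\<omega>. (X i \<omega>)\<^sup>2)"
    and mean: "\<And>i. expectation (X i) = 0"
    and var: "\<And>i. expectation (\<lambda>\<omega>. (X i \<omega>)\<^sup>2) = v"
  shows "integrable M (\<lambda>\<omega>. (\<Sum>i<n. X i \<omega>)\<^sup>2) \<and> expectation (\<lambda>\<omega>. (\<Sum>i<n. X i \<omega>)\<^sup>2) = n * v"
proof (induction n)
  case 0
  then show ?case by simp
next
  case (Suc n)
  have [measurable]: "X i \<in> borel_measurable M" for i
    using indep by (auto simp: indep_vars_def2)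
  have X: "integrable M (X i)" for i
    by (rule square_integrable_imp_integrable[OF _ sq]) simp
  have "indep_vars (\<lambda>_. borel) X (insert n {..<n})"
    using indep by (rule indep_vars_subset) simp
  then have ind: "indep_var borel (X n) borel (\<lambda>\<omega>. \<Sum>i<n. X i \<omega>)"
    by (intro indep_vars_sum) auto
  have S: "integrable M (\<lambda>\<omega>. \<Sum>i<n. X i \<omega>)" using X by simp
  have prod: "integrable M (\<lambda>\<omega>. X n \<omega> * (\<Sum>i<n. X i \<omega>))"
    "expectation (\<lambda>\<omega>. X n \<omega> * (\<Sum>i<n. X i \<omega>)) = 0"
    using indep_var_integrable[OF ind X S] indep_var_lebesgue_integral[OF ind X S] mean by auto
  have eq: "(\<Sum>i<Suc n. X i \<omega>)\<^sup>2 =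
      (\<Sum>i<n. X i \<omega>)\<^sup>2 + 2 * (X n \<omega> * (\<Sum>i<n. X i \<omega>)) + (X n \<omega>)\<^sup>2" for \<omega>
    by (simp add: power2_sum)
  show ?case unfolding eq using Suc prod sq var by (simp add: algebra_simps)
qed

text \<open>The classical limit theorem divides by the standard deviation, but linear forms of a
  singular limit can have variance zero. In that case the second moment of the sum is zero, hence
  the sum vanishes almost everywhere.\<close>

lemma (in prob_space) char_scaled_sum_tendsto:
  fixes X :: "nat \<Rightarrow> 'a \<Rightarrow> real"
  assumes indep: "indep_vars (\<lambda>_. borel) X UNIV"
    and sq: "\<And>i. integrable M (\<lambda>\<omega>. (X i \<omega>)\<^sup>2)"
    and mean: "\<And>i. expectation (X i) = 0"
    and var: "\<And>i. expectation (\<lambda>\<omega>. (X i \<omega>)\<^sup>2) = v"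
    and distr: "\<And>i. distr M borel (X i) = \<mu>"
  shows "(\<lambda>n. CLINT \<omega>|M. iexp ((\<Sum>i<n. X i \<omega>) / sqrt n)) \<longlonglongrightarrow> exp (- v / 2)"
proof -
  have [measurable]: "X i \<in> borel_measurable M" for i
    using indep by (auto simp: indep_vars_def2)
  have "0 \<le> expectation (\<lambda>\<omega>. (X 0 \<omega>)\<^sup>2)" by simp
  then consider "v = 0" | "v > 0" unfolding var by linarith
  then show ?thesis
  proof cases
    case 1
    have "(CLINT \<omega>|M. iexp ((\<Sum>i<n. X i \<omega>) / sqrt n)) = (CLINT \<omega>|M. 1)" for n
    proof (rule integral_cong_AE)
      have "AE \<omega> in M. (\<Sum>i<n. X i \<omega>)\<^sup>2 = 0"
        using indep_sum_second_moment[OF indep sq mean var, of n] 1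
        by (subst integral_nonneg_eq_0_iff_AE[symmetric]) auto
      then show "AE \<omega> in M. iexp ((\<Sum>i<n. X i \<omega>) / sqrt n) = 1" by eventually_elim simp
    qed auto
    then show ?thesis using 1 by (simp add: prob_space)
  next
    case 2
    let ?S = "\<lambda>n \<omega>. (\<Sum>i<n. X i \<omega>) / sqrt (n * (sqrt v)\<^sup>2)"
    have "weak_conv_m (\<lambda>n. distr M borel (?S n)) std_normal_distribution"
      by (rule central_limit_theorem_zero_mean[OF indep mean _ sq _ distr]) (use 2 mean var in auto)
    \<comment> \<open>Evaluating the characteristic function at \<open>sqrt v\<close> undoes the
      standardisation.\<close>
    then have "(\<lambda>n. char (distr M borel (?S n)) (sqrt v)) \<longlonglongrightarrow> char std_normal_distribution (sqrt v)"
      by (intro levy_continuity1 real_distribution_distr real_dist_normal_dist) auto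
    moreover have "char (distr M borel (?S n)) (sqrt v) = (CLINT \<omega>|M. iexp ((\<Sum>i<n. X i \<omega>) / sqrt n))" for n
    proof -
      have "sqrt v * ?S n \<omega> = (\<Sum>i<n. X i \<omega>) / sqrt n" for \<omega>
        using 2 by (simp add: real_sqrt_mult)
      then show ?thesis unfolding char_def by (subst integral_distr) (auto simp del: of_real_mult)
    qed
    moreover have "char std_normal_distribution (sqrt v) = exp (- v / 2)"
      using 2 by (simp add: char_std_normal_distribution)
    ultimately show ?thesis by simp
  qed
qed

text \<open>Slutsky's argument: \<open>iexp\<close> is 1-Lipschitz with values on the unit circle,
  so the integrands differ by at most |t| e off the exceptional event and by at most 2 on
  it.\<close>

lemma (in prob_space) char_tendsto_of_diff_in_prob:
  fixes Z Z' :: "nat \<Rightarrow> 'a \<Rightarrow> 'b :: euclidean_space"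
  assumes [measurable]: "\<And>n. Z n \<in> borel_measurable M" "\<And>n. Z' n \<in> borel_measurable M"
    and diff: "\<And>e. 0 < e \<Longrightarrow> (\<lambda>n. prob {\<omega> \<in> space M. e < norm (Z' n \<omega> - Z n \<omega>)}) \<longlonglongrightarrow> 0"
    and lim: "(\<lambda>n. CLINT \<omega>|M. iexp (t \<bullet> Z n \<omega>)) \<longlonglongrightarrow> l"
  shows "(\<lambda>n. CLINT \<omega>|M. iexp (t \<bullet> Z' n \<omega>)) \<longlonglongrightarrow> l"
proof -
  have "(\<lambda>n. (CLINT \<omega>|M. iexp (t \<bullet> Z' n \<omega>)) - (CLINT \<omega>|M. iexp (t \<bullet> Z n \<omega>))) \<longlonglongrightarrow> 0"
  proof (rule LIMSEQ_I)
    fix r :: real assume "0 < r"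
    \<comment> \<open>The summand 1 covers t = 0 and makes |t| e strictly less than r / 2.\<close>
    define e where "e = r / (2 * (norm t + 1))"
    have e: "0 < e" using \<open>0 < r\<close> by (simp add: e_def add_nonneg_pos)
    have te: "norm t * e < r / 2"
    proof -
      have "norm t * e < (norm t + 1) * e" using e by simp
      also have "\<dots> = r / 2" using norm_ge_zero[of t] by (simp add: e_def divide_simps) (smt (verit) norm_ge_zero)
      finally show ?thesis .
    qed
    have [simp]: "integrable M (\<lambda>\<omega>. iexp (t \<bullet> Z n \<omega>))" "integrable M (\<lambda>\<omega>. iexp (t \<bullet> Z' n \<omega>))" for n
      by (auto intro!: integrable_const_bound[where B = 1])
    let ?A = "\<lambda>n. {\<omega> \<in> space M. e < norm (Z' n \<omega> - Z n \<omega>)}"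
    have bound: "cmod ((CLINT \<omega>|M. iexp (t \<bullet> Z' n \<omega>)) - (CLINT \<omega>|M. iexp (t \<bullet> Z n \<omega>)))
        \<le> norm t * e + 2 * prob (?A n)" for n
    proof -
      have "cmod ((CLINT \<omega>|M. iexp (t \<bullet> Z' n \<omega>)) - (CLINT \<omega>|M. iexp (t \<bullet> Z n \<omega>)))
          = cmod (CLINT \<omega>|M. iexp (t \<bullet> Z' n \<omega>) - iexp (t \<bullet> Z n \<omega>))" by simp
      also have "\<dots> \<le> (\<integral>\<omega>. cmod (iexp (t \<bullet> Z' n \<omega>) - iexp (t \<bullet> Z n \<omega>)) \<partial>M)"
        by (rule integral_norm_bound)
      also have "\<dots> \<le> (\<integral>\<omega>. norm t * e + 2 * indicator (?A n) \<omega> \<partial>M)"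
      proof (rule integral_mono)
        fix \<omega> assume \<omega>: "\<omega> \<in> space M"
        show "cmod (iexp (t \<bullet> Z' n \<omega>) - iexp (t \<bullet> Z n \<omega>)) \<le> norm t * e + 2 * indicator (?A n) \<omega>"
        proof (cases "\<omega> \<in> ?A n")
          case True
          have "cmod (iexp (t \<bullet> Z' n \<omega>) - iexp (t \<bullet> Z n \<omega>)) \<le> 2"
            by (rule norm_triangle_le_diff) simp
          moreover have "0 \<le> norm t * e" using e by simp
          ultimately show ?thesis using True by simp
        next
          case False
          have "cmod (iexp (t \<bullet> Z' n \<omega>) - iexp (t \<bullet> Z n \<omega>)) \<le> \<bar>t \<bullet> (Z' n \<omega> - Z n \<omega>)\<bar>"
            using cmod_iexp_diff_le by (simp add: inner_diff_right)
          also have "\<dots> \<le> norm t * norm (Z' n \<omega> - Z n \<omega>)" by (rule Cauchy_Schwarz_ineq2)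
          also have "\<dots> \<le> norm t * e" using False \<omega> by (intro mult_left_mono) auto
          finally show ?thesis using False by simp
        qed
      qed (auto intro!: integrable_norm integrable_real_indicator simp: emeasure_eq_measure)
      also have "\<dots> = norm t * e + 2 * prob (?A n)"
        by (simp add: prob_space emeasure_eq_measure)
      finally show ?thesis .
    qed
    have "\<forall>\<^sub>F n in sequentially. prob (?A n) < r / 4"
      by (rule order_tendstoD(2)[OF diff[OF e]]) (use \<open>0 < r\<close> in simp)
    then have "\<forall>\<^sub>F n in sequentially.
        cmod ((CLINT \<omega>|M. iexp (t \<bullet> Z' n \<omega>)) - (CLINT \<omega>|M. iexp (t \<bullet> Z n \<omega>))) < r"
    proof eventually_elim
      case (elim n)
      then show ?case using bound[of n] te by linarith
    qed
    then show "\<exists>N. \<forall>n\<ge>N. norm ((CLINT \<omega>|M. iexp (t \<bullet> Z' n \<omega>)) - (CLINT \<omega>|M. iexp (t \<bullet> Z n \<omega>)) - 0) < r"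
      by (simp add: eventually_sequentially)
  qed
  from tendsto_add[OF this lim] show ?thesis by simp
qed

text \<open>The rescaled error is compared with D applied to the scaled centred sum. Linear forms of
  the latter are scaled sums of i.i.d. real variables, so V is specified through the variances of
  these forms only. The factor A makes the characteristic function of \<open>mv_normal 0 V\<close>
  available.\<close>

theorem (in prob_space) delta_method_clt:
  fixes \<xi> :: "nat \<Rightarrow> 'a \<Rightarrow> 'e :: euclidean_space" and G :: "'e \<Rightarrow> real ^ 'p"
    and A V :: "real ^ 'p ^ 'p"
  assumes indep: "indep_vars (\<lambda>_. borel) \<xi> UNIV"
    and distr: "\<And>i. distr M borel (\<xi> i) = \<nu>"
    and sq: "integrable M (\<lambda>\<omega>. (norm (\<xi> 0 \<omega>))\<^sup>2)"
    and m: "expectation (\<xi> 0) = m"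
    and G: "(G has_derivative D) (at m)"
    and [measurable]: "G \<in> borel_measurable borel"
    and A: "A ** transpose A = V"
    and var: "\<And>t. expectation (\<lambda>\<omega>. (t \<bullet> D (\<xi> 0 \<omega> - m))\<^sup>2) = t \<bullet> (V *v t)"
  shows "converges_in_distribution M
    (\<lambda>n \<omega>. sqrt n *\<^sub>R (G ((\<Sum>i<n. \<xi> i \<omega>) /\<^sub>R real n) - G m)) (mv_normal 0 V)"
    (is "converges_in_distribution M ?Z _")
proof -
  have [measurable]: "\<xi> i \<in> borel_measurable M" for i
    using indep by (auto simp: indep_vars_def2)
  interpret D: bounded_linear D using G by (rule has_derivative_bounded_linear)
  have [measurable]: "D \<in> borel_measurable borel"
    by (intro borel_measurable_continuous_onI D.continuous_on continuous_on_id)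
  have \<nu>0: "\<nu> = distr M borel (\<xi> 0)" using distr[of 0] by simp
  have transfer: "expectation (\<lambda>\<omega>. h (\<xi> i \<omega>)) = expectation (\<lambda>\<omega>. h (\<xi> 0 \<omega>))"
    "integrable M (\<lambda>\<omega>. h (\<xi> i \<omega>)) \<longleftrightarrow> integrable M (\<lambda>\<omega>. h (\<xi> 0 \<omega>))"
    if [measurable]: "h \<in> borel_measurable borel" for h :: "'e \<Rightarrow> real" and i
    using integral_distr[of "\<xi> i" M borel h] integral_distr[of "\<xi> 0" M borel h]
      integrable_distr_eq[of "\<xi> i" M borel h] integrable_distr_eq[of "\<xi> 0" M borel h] distr
    by auto
  have int: "integrable M (\<xi> 0)"
  proof (rule Bochner_Integration.integrable_bound)
    show "integrable M (\<lambda>\<omega>. 1 + (norm (\<xi> 0 \<omega>))\<^sup>2)" using sq by simp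
    show "AE \<omega> in M. norm (\<xi> 0 \<omega>) \<le> norm (1 + (norm (\<xi> 0 \<omega>))\<^sup>2)"
      by (intro AE_I2 norm_le_norm_one_plus_square)
  qed simp
  have centred: "integrable M (\<lambda>\<omega>. (l (\<xi> 0 \<omega> - m))\<^sup>2)"
    "expectation (\<lambda>\<omega>. l (\<xi> 0 \<omega> - m)) = 0"
    if l: "bounded_linear l" for l :: "'e \<Rightarrow> real"
  proof -
    interpret l: bounded_linear l by fact
    have [measurable]: "l \<in> borel_measurable borel"
      by (intro borel_measurable_continuous_onI l.continuous_on continuous_on_id)
    obtain K where K: "\<And>x. norm (l x) \<le> norm x * K" "0 < K" using l.pos_bounded by blast
    show "integrable M (\<lambda>\<omega>. (l (\<xi> 0 \<omega> - m))\<^sup>2)"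
    proof (rule Bochner_Integration.integrable_bound)
      show "integrable M (\<lambda>\<omega>. 2 * K\<^sup>2 * ((norm (\<xi> 0 \<omega>))\<^sup>2 + (norm m)\<^sup>2))" using sq by simp
      have "(l (x - m))\<^sup>2 \<le> 2 * K\<^sup>2 * ((norm x)\<^sup>2 + (norm m)\<^sup>2)" for x
      proof -
        have "\<bar>l (x - m)\<bar> \<le> (norm x + norm m) * K"
          using K(1)[of "x - m"] norm_triangle_ineq4[of x m] K(2)
          by (smt (verit) mult_right_mono real_norm_def)
        then have "(l (x - m))\<^sup>2 \<le> ((norm x + norm m) * K)\<^sup>2"
          by (metis abs_ge_zero power2_abs power_mono)
        also have "\<dots> = K\<^sup>2 * (norm x + norm m)\<^sup>2" by (simp add: power_mult_distrib)
        also have "\<dots> \<le> K\<^sup>2 * (2 * ((norm x)\<^sup>2 + (norm m)\<^sup>2))"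
          using sum_squares_bound[of "norm x" "norm m"] by (intro mult_left_mono) (auto simp: power2_sum)
        finally show ?thesis by (simp add: algebra_simps)
      qed
      then show "AE \<omega> in M. norm ((l (\<xi> 0 \<omega> - m))\<^sup>2) \<le> norm (2 * K\<^sup>2 * ((norm (\<xi> 0 \<omega>))\<^sup>2 + (norm m)\<^sup>2))"
        by simp
    qed simp
    show "expectation (\<lambda>\<omega>. l (\<xi> 0 \<omega> - m)) = 0"
      using integral_bounded_linear[OF l, of M "\<lambda>\<omega>. \<xi> 0 \<omega> - m"] int m
      by (simp add: prob_space l.zero)
  qed
  \<comment> \<open>The hypotheses of the one-dimensional results, prepared for every linear
    functional at once: coordinates are used for tightness, t composed with D for the limit.\<close>
  have family: "indep_vars (\<lambda>_. borel) (\<lambda>i \<omega>. l (\<xi> i \<omega> - m)) UNIV"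
    "\<And>i. integrable M (\<lambda>\<omega>. (l (\<xi> i \<omega> - m))\<^sup>2)"
    "\<And>i. expectation (\<lambda>\<omega>. l (\<xi> i \<omega> - m)) = 0"
    "\<And>i. expectation (\<lambda>\<omega>. (l (\<xi> i \<omega> - m))\<^sup>2) = expectation (\<lambda>\<omega>. (l (\<xi> 0 \<omega> - m))\<^sup>2)"
    "\<And>i. distr M borel (\<lambda>\<omega>. l (\<xi> i \<omega> - m)) = distr \<nu> borel (\<lambda>x. l (x - m))"
    if l: "bounded_linear l" for l :: "'e \<Rightarrow> real"
  proof -
    interpret l: bounded_linear l by fact
    have [measurable]: "l \<in> borel_measurable borel"
      by (intro borel_measurable_continuous_onI l.continuous_on continuous_on_id)
    show "indep_vars (\<lambda>_. borel) (\<lambda>i \<omega>. l (\<xi> i \<omega> - m)) UNIV"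
      using indep by (rule indep_vars_compose2) simp
    show "integrable M (\<lambda>\<omega>. (l (\<xi> i \<omega> - m))\<^sup>2)" for i
      by (subst transfer(2)[of "\<lambda>x. (l (x - m))\<^sup>2"]) (auto intro!: centred(1)[OF l])
    show "expectation (\<lambda>\<omega>. l (\<xi> i \<omega> - m)) = 0" for i
      by (subst transfer(1)[of "\<lambda>x. l (x - m)"]) (auto intro!: centred(2)[OF l])
    show "expectation (\<lambda>\<omega>. (l (\<xi> i \<omega> - m))\<^sup>2) = expectation (\<lambda>\<omega>. (l (\<xi> 0 \<omega> - m))\<^sup>2)" for i
      by (subst transfer(1)[of "\<lambda>x. (l (x - m))\<^sup>2"]) auto
    show "distr M borel (\<lambda>\<omega>. l (\<xi> i \<omega> - m)) = distr \<nu> borel (\<lambda>x. l (x - m))" for i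
      unfolding distr[of i, symmetric] by (subst distr_distr) (auto simp: comp_def)
  qed
  define U where "U n \<omega> = (\<Sum>i<n. \<xi> i \<omega> - m) /\<^sub>R sqrt n" for n \<omega>
  have [measurable]: "U n \<in> borel_measurable M" for n unfolding U_def by measurable
  have lU: "l (U n \<omega>) = (\<Sum>i<n. l (\<xi> i \<omega> - m)) / sqrt n" if "bounded_linear l" for l :: "'e \<Rightarrow> real" and n \<omega>
  proof -
    interpret l: bounded_linear l by fact
    show ?thesis by (simp add: U_def l.scaleR l.sum divide_inverse_commute)
  qed
  define C where "C = (\<Sum>b\<in>Basis. expectation (\<lambda>\<omega>. ((\<xi> 0 \<omega> - m) \<bullet> b)\<^sup>2))"
  have "0 \<le> C" unfolding C_def by (intro sum_nonneg integral_nonneg_AE) auto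
  \<comment> \<open>C is the trace of the covariance of one observation. There is equality for n >
    0; the inequality absorbs n = 0, where \<open>U n\<close> is zero.\<close>
  have U_sq: "integrable M (\<lambda>\<omega>. (norm (U n \<omega>))\<^sup>2)" "expectation (\<lambda>\<omega>. (norm (U n \<omega>))\<^sup>2) \<le> C" for n
  proof -
    have comp: "integrable M (\<lambda>\<omega>. (U n \<omega> \<bullet> b)\<^sup>2)"
      "expectation (\<lambda>\<omega>. (U n \<omega> \<bullet> b)\<^sup>2) \<le> expectation (\<lambda>\<omega>. ((\<xi> 0 \<omega> - m) \<bullet> b)\<^sup>2)" for b
    proof -
      have bl: "bounded_linear (\<lambda>x :: 'e. x \<bullet> b)" by (rule bounded_linear_inner_left)
      note sm = indep_sum_second_moment[OF family(1-4)[OF bl], of n]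
      have eq: "(U n \<omega> \<bullet> b)\<^sup>2 = (\<Sum>i<n. (\<xi> i \<omega> - m) \<bullet> b)\<^sup>2 / n" for \<omega>
        using lU[OF bl] by (simp add: power_divide)
      show "integrable M (\<lambda>\<omega>. (U n \<omega> \<bullet> b)\<^sup>2)" unfolding eq using sm by simp
      show "expectation (\<lambda>\<omega>. (U n \<omega> \<bullet> b)\<^sup>2) \<le> expectation (\<lambda>\<omega>. ((\<xi> 0 \<omega> - m) \<bullet> b)\<^sup>2)"
        unfolding eq using sm by (cases "n = 0") auto
    qed
    have eq: "(norm (U n \<omega>))\<^sup>2 = (\<Sum>b\<in>Basis. (U n \<omega> \<bullet> b)\<^sup>2)" for \<omega>
      unfolding power2_norm_eq_inner by (subst euclidean_inner) (simp add: power2_eq_square)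
    show "integrable M (\<lambda>\<omega>. (norm (U n \<omega>))\<^sup>2)" "expectation (\<lambda>\<omega>. (norm (U n \<omega>))\<^sup>2) \<le> C"
      unfolding eq C_def using comp by (auto intro!: sum_mono)
  qed
  have U_tail: "prob {\<omega> \<in> space M. K < norm (U n \<omega>)} \<le> C / K\<^sup>2" if "0 < K" for K n
  proof -
    have "prob {\<omega> \<in> space M. K < norm (U n \<omega>)} \<le> prob {\<omega> \<in> space M. K\<^sup>2 \<le> (norm (U n \<omega>))\<^sup>2}"
      using that by (intro finite_measure_mono) (auto intro!: power_mono)
    also have "\<dots> \<le> expectation (\<lambda>\<omega>. (norm (U n \<omega>))\<^sup>2) / K\<^sup>2"
      by (rule integral_Markov_inequality_measure[OF U_sq(1), of "{}"]) (use that in auto)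
    also have "\<dots> \<le> C / K\<^sup>2" using U_sq(2) by (intro divide_right_mono) auto
    finally show ?thesis .
  qed
  have U_tight: "\<exists>K>0. \<forall>n. prob {\<omega> \<in> space M. K < norm (U n \<omega>)} \<le> e" if "0 < e" for e
  proof -
    \<comment> \<open>Chosen so that Markov's bound C / K^2 is at most e; the 1 keeps K positive
      when C = 0.\<close>
    define K where "K = sqrt (C / e) + 1"
    have K: "K > 0" using \<open>0 \<le> C\<close> that by (simp add: K_def add_nonneg_pos)
    have "C / e \<le> K\<^sup>2"
    proof -
      have "C / e = (sqrt (C / e))\<^sup>2" using \<open>0 \<le> C\<close> that by simp
      also have "\<dots> \<le> K\<^sup>2" unfolding K_def using \<open>0 \<le> C\<close> that by (intro power_mono) auto
      finally show ?thesis .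
    qed
    then have "C / K\<^sup>2 \<le> e" using K that by (simp add: field_simps)
    with U_tail[OF K] K show ?thesis by (meson order_trans)
  qed
  \<comment> \<open>On the event that |U| \<le> K the average is within K / sqrt n of m. For large n
    this is inside the ball where the remainder of G is at most \<eta> / K times the distance, and
    multiplying by sqrt n leaves at most \<eta>. Only the event |U| > K, whose probability is small
    uniformly in n, remains.\<close>
  have diff: "(\<lambda>n. prob {\<omega> \<in> space M. \<eta> < norm (?Z n \<omega> - D (U n \<omega>))}) \<longlonglongrightarrow> 0" if "0 < \<eta>" for \<eta>
  proof (rule LIMSEQ_I)
    fix e :: real assume "0 < e"
    then obtain K where K: "0 < K" "\<And>n. prob {\<omega> \<in> space M. K < norm (U n \<omega>)} \<le> e / 2"
      using U_tight[of "e / 2"] by auto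
    have "0 < \<eta> / K" using K that by simp
    then obtain d where d: "0 < d"
      "\<And>y. norm (y - m) < d \<Longrightarrow> norm (G y - G m - D (y - m)) \<le> \<eta> / K * norm (y - m)"
      using G unfolding has_derivative_at_alt by metis
    obtain N :: nat where N: "(K / d)\<^sup>2 < N" using reals_Archimedean2 by blast
    show "\<exists>N. \<forall>n\<ge>N. norm (prob {\<omega> \<in> space M. \<eta> < norm (?Z n \<omega> - D (U n \<omega>))} - 0) < e"
    proof (intro exI allI impI)
      fix n assume "N \<le> n"
      then have n: "(K / d)\<^sup>2 < n" using N by simp
      then have "0 < n" using zero_le_power2[of "K / d"] by (metis of_nat_0_less_iff order_le_less_trans)
      have sn: "K / d < sqrt n" using real_less_rsqrt[OF n] .
      have "norm (?Z n \<omega> - D (U n \<omega>)) \<le> \<eta>" if "norm (U n \<omega>) \<le> K" for \<omega>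
      proof -
        define y where "y = (\<Sum>i<n. \<xi> i \<omega>) /\<^sub>R real n"
        have y: "y - m = U n \<omega> /\<^sub>R sqrt n"
        proof -
          have "U n \<omega> /\<^sub>R sqrt n = (\<Sum>i<n. \<xi> i \<omega> - m) /\<^sub>R real n"
            by (simp add: U_def flip: inverse_mult_distrib)
          also have "\<dots> = y - m"
            using \<open>0 < n\<close> by (simp add: y_def sum_subtractf scaleR_diff_right)
              (simp only: sum_constant_scaleR scaleR_scaleR card_lessThan, simp)
          finally show ?thesis ..
        qed
        then have ny: "norm (y - m) = norm (U n \<omega>) / sqrt n"
          by (simp add: divide_inverse_commute)
        also have "\<dots> \<le> K / sqrt n" using that by (simp add: divide_right_mono)
        also have "\<dots> < d" using sn d(1) \<open>0 < n\<close> by (simp add: field_simps)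
        finally have "norm (G y - G m - D (y - m)) \<le> \<eta> / K * norm (y - m)" by (rule d(2))
        then have "sqrt n * norm (G y - G m - D (y - m)) \<le> sqrt n * (\<eta> / K * norm (y - m))"
          by (intro mult_left_mono) auto
        also have "\<dots> = \<eta> / K * norm (U n \<omega>)" using \<open>0 < n\<close> by (simp add: ny)
        also have "\<dots> \<le> \<eta> / K * K" using that \<open>0 < \<eta> / K\<close> by (intro mult_left_mono) auto
        also have "\<dots> = \<eta>" using K(1) by simp
        finally have "sqrt n * norm (G y - G m - D (y - m)) \<le> \<eta>" .
        moreover have "?Z n \<omega> - D (U n \<omega>) = sqrt n *\<^sub>R (G y - G m - D (y - m))"
          using \<open>0 < n\<close> by (simp add: y D.scaleR scaleR_diff_right) (simp add: y_def)
        ultimately show ?thesis by simp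
      qed
      then have "prob {\<omega> \<in> space M. \<eta> < norm (?Z n \<omega> - D (U n \<omega>))} \<le> prob {\<omega> \<in> space M. K < norm (U n \<omega>)}"
        by (intro finite_measure_mono) (auto simp: not_le[symmetric])
      with K(2)[of n] \<open>0 < e\<close> show "norm (prob {\<omega> \<in> space M. \<eta> < norm (?Z n \<omega> - D (U n \<omega>))} - 0) < e"
        by simp
    qed
  qed
  have charDU: "(\<lambda>n. CLINT \<omega>|M. iexp (t \<bullet> D (U n \<omega>))) \<longlonglongrightarrow> exp (- (t \<bullet> (V *v t)) / 2)" for t
  proof -
    have bl: "bounded_linear (\<lambda>x. t \<bullet> D x)"
      using bounded_linear_compose[OF bounded_linear_inner_right D.bounded_linear_axioms] .
    have "(\<lambda>n. CLINT \<omega>|M. iexp ((\<Sum>i<n. t \<bullet> D (\<xi> i \<omega> - m)) / sqrt n)) \<longlonglongrightarrow>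
        exp (- expectation (\<lambda>\<omega>. (t \<bullet> D (\<xi> 0 \<omega> - m))\<^sup>2) / 2)"
      by (rule char_scaled_sum_tendsto[OF family[OF bl]])
    then show ?thesis unfolding var lU[OF bl, symmetric] .
  qed
  show ?thesis
  proof (rule levy_continuity_mv)
    show "prob_space M" by unfold_locales
    show Zm: "?Z n \<in> borel_measurable M" for n by measurable
    show "prob_space (mv_normal 0 V)" by (rule prob_space_mv_normal)
    show "sets (mv_normal 0 V) = sets borel" by (simp add: mv_normal_def)
    show "(\<lambda>n. CLINT \<omega>|M. iexp (t \<bullet> ?Z n \<omega>)) \<longlonglongrightarrow> (CLINT x|mv_normal 0 V. iexp (t \<bullet> x))" for t
    proof (rule char_tendsto_of_diff_in_prob[OF _ Zm diff])
      show "(\<lambda>n. CLINT \<omega>|M. iexp (t \<bullet> D (U n \<omega>))) \<longlonglongrightarrow> (CLINT x|mv_normal 0 V. iexp (t \<bullet> x))"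
        using charDU[of t] char_mv_normal[OF A, of 0 t] by simp
    qed measurable
    \<comment> \<open>Tightness passes from U to D U by boundedness of D, and on to the rescaled
      error because the difference exceeds 1 with vanishing probability.\<close>
    show "\<exists>K. \<forall>\<^sub>F n in sequentially. prob {\<omega> \<in> space M. K < norm (?Z n \<omega>)} \<le> e" if "0 < e" for e
    proof -
      obtain K where K: "0 < K" "\<And>n. prob {\<omega> \<in> space M. K < norm (U n \<omega>)} \<le> e / 2"
        using U_tight[of "e / 2"] \<open>0 < e\<close> by auto
      obtain L where L: "\<And>x. norm (D x) \<le> norm x * L" "0 < L" using D.pos_bounded by blast
      have "\<forall>\<^sub>F n in sequentially. prob {\<omega> \<in> space M. 1 < norm (?Z n \<omega> - D (U n \<omega>))} < e / 2"
        by (rule order_tendstoD(2)[OF diff]) (use that in auto)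
      then have "\<forall>\<^sub>F n in sequentially. prob {\<omega> \<in> space M. K * L + 1 < norm (?Z n \<omega>)} \<le> e"
      proof eventually_elim
        case (elim n)
        have "{\<omega> \<in> space M. K * L + 1 < norm (?Z n \<omega>)} \<subseteq>
            {\<omega> \<in> space M. 1 < norm (?Z n \<omega> - D (U n \<omega>))} \<union> {\<omega> \<in> space M. K < norm (U n \<omega>)}"
        proof (intro subsetI, rule ccontr)
          fix \<omega>
          assume \<omega>: "\<omega> \<in> {\<omega> \<in> space M. K * L + 1 < norm (?Z n \<omega>)}"
            "\<omega> \<notin> {\<omega> \<in> space M. 1 < norm (?Z n \<omega> - D (U n \<omega>))} \<union> {\<omega> \<in> space M. K < norm (U n \<omega>)}"
          then have "norm (U n \<omega>) * L \<le> K * L" using L(2) by (intro mult_right_mono) auto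
          then show False
            using \<omega> L(1)[of "U n \<omega>"] norm_triangle_sub[of "?Z n \<omega>" "D (U n \<omega>)"] by auto
        qed
        then have "prob {\<omega> \<in> space M. K * L + 1 < norm (?Z n \<omega>)} \<le>
            prob ({\<omega> \<in> space M. 1 < norm (?Z n \<omega> - D (U n \<omega>))} \<union> {\<omega> \<in> space M. K < norm (U n \<omega>)})"
          by (intro finite_measure_mono) auto
        also have "\<dots> \<le> prob {\<omega> \<in> space M. 1 < norm (?Z n \<omega> - D (U n \<omega>))} +
            prob {\<omega> \<in> space M. K < norm (U n \<omega>)}"
          by (intro measure_Un_le) auto
        finally show ?case using K(2)[of n] elim by linarith
      qed
      then show ?thesis ..
    qed
  qed
qed

section \<open>Moments of the multivariate normal distribution\<close>

context
  fixes A V :: "real ^ 'p ^ 'p"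
  assumes A: "A ** transpose A = V"
begin

lemma factorized_symmetric: "u \<bullet> (V *v v) = v \<bullet> (V *v u)"
proof -
  have "transpose V = V" by (simp add: A[symmetric] matrix_transpose_mul)
  then show ?thesis by (metis dot_lmul_matrix vector_transpose_matrix inner_commute)
qed

lemma factorized_nonneg: "0 \<le> u \<bullet> (V *v u)"
proof -
  have "u \<bullet> (V *v u) = (transpose A *v u) \<bullet> (transpose A *v u)"
    by (simp add: A[symmetric] matrix_vector_mul_assoc[symmetric] dot_lmul_matrix)
  then show ?thesis by simp
qed

text \<open>The characteristic function of u'x at t is that of x at t u. Identifying the whole
  one-dimensional law reduces all moments below to standard normal ones, also when u' V u =
  0.\<close>

lemma distr_inner_mv_normal:
  "distr (mv_normal 0 V) borel (\<lambda>x. u \<bullet> x) =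
     distr std_normal_distribution borel (\<lambda>z. sqrt (u \<bullet> (V *v u)) * z)"
proof (rule Levy_uniqueness)
  interpret S: real_distribution std_normal_distribution by (rule real_dist_normal_dist)
  interpret N: prob_space "mv_normal 0 V" by (rule prob_space_mv_normal)
  have m[measurable]: "(\<lambda>x. u \<bullet> x) \<in> borel_measurable (mv_normal 0 V)"
    by (simp add: mv_normal_def)
  show "real_distribution (distr (mv_normal 0 V) borel (\<lambda>x. u \<bullet> x))"
    using m by (rule N.real_distribution_distr)
  show "real_distribution (distr std_normal_distribution borel (\<lambda>z. sqrt (u \<bullet> (V *v u)) * z))"
    by (rule S.real_distribution_distr) simp
  show "char (distr (mv_normal 0 V) borel (\<lambda>x. u \<bullet> x)) =
      char (distr std_normal_distribution borel (\<lambda>z. sqrt (u \<bullet> (V *v u)) * z))"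
  proof
    fix t
    let ?s = "sqrt (u \<bullet> (V *v u))"
    have "char (distr (mv_normal 0 V) borel (\<lambda>x. u \<bullet> x)) t = (CLINT x|mv_normal 0 V. iexp ((t *\<^sub>R u) \<bullet> x))"
      unfolding char_def by (subst integral_distr) auto
    also have "\<dots> = exp (- (t\<^sup>2 * (u \<bullet> (V *v u))) / 2)"
      using char_mv_normal[OF A, of 0 "t *\<^sub>R u"]
      by (simp add: matrix_vector_mult_scaleR power2_eq_square mult.assoc)
    also have "\<dots> = exp (- (t * ?s)\<^sup>2 / 2)"
      using factorized_nonneg[of u] by (simp add: power_mult_distrib)
    also have "\<dots> = char std_normal_distribution (t * ?s)"
      by (simp add: char_std_normal_distribution)
    also have "\<dots> = char (distr std_normal_distribution borel (\<lambda>z. ?s * z)) t"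
      unfolding char_def by (subst integral_distr) (auto simp: mult.assoc)
    finally show "char (distr (mv_normal 0 V) borel (\<lambda>x. u \<bullet> x)) t = \<dots>" .
  qed
qed

lemma measurable_inner_mv_normal: "(\<lambda>x. u \<bullet> x) \<in> borel_measurable (mv_normal m V)"
  by (simp add: mv_normal_def)

lemma mv_normal_moment:
  "integrable (mv_normal 0 V) (\<lambda>x. (u \<bullet> x) ^ k)"
  "(\<integral>x. (u \<bullet> x) ^ k \<partial>mv_normal 0 V) =
     sqrt (u \<bullet> (V *v u)) ^ k * (\<integral>z. z ^ k \<partial>std_normal_distribution)"
proof -
  let ?s = "sqrt (u \<bullet> (V *v u))"
  have "integrable (distr std_normal_distribution borel (\<lambda>z. ?s * z)) (\<lambda>x. x ^ k)"
    by (subst integrable_distr_eq) (auto simp: power_mult_distrib integrable_std_normal_distribution_moment)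
  then show "integrable (mv_normal 0 V) (\<lambda>x. (u \<bullet> x) ^ k)"
    unfolding distr_inner_mv_normal[symmetric]
    by (subst (asm) integrable_distr_eq) (auto simp: measurable_inner_mv_normal)
  have "(\<integral>x. (u \<bullet> x) ^ k \<partial>mv_normal 0 V) = (\<integral>x. x ^ k \<partial>distr (mv_normal 0 V) borel (\<lambda>x. u \<bullet> x))"
    by (subst integral_distr) (auto simp: measurable_inner_mv_normal)
  also have "\<dots> = (\<integral>z. (?s * z) ^ k \<partial>std_normal_distribution)"
    unfolding distr_inner_mv_normal by (subst integral_distr) auto
  finally show "(\<integral>x. (u \<bullet> x) ^ k \<partial>mv_normal 0 V) = ?s ^ k * (\<integral>z. z ^ k \<partial>std_normal_distribution)"
    by (simp add: power_mult_distrib)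
qed

lemma mv_normal_moment_1:
  "integrable (mv_normal 0 V) (\<lambda>x. u \<bullet> x)" "(\<integral>x. u \<bullet> x \<partial>mv_normal 0 V) = 0"
  using mv_normal_moment[of u 1] integral_std_normal_distribution_moment_odd[of 1] by auto

lemma mv_normal_moment_2: "(\<integral>x. (u \<bullet> x)\<^sup>2 \<partial>mv_normal 0 V) = u \<bullet> (V *v u)"
  using mv_normal_moment(2)[of u 2] std_normal_distribution_even_moments(1)[of 1] factorized_nonneg[of u]
  by simp

lemma mv_normal_moment_4: "(\<integral>x. (u \<bullet> x) ^ 4 \<partial>mv_normal 0 V) = 3 * (u \<bullet> (V *v u))\<^sup>2"
proof -
  have "(LINT x|std_normal_distribution. x ^ 4) = 3"
    using std_normal_distribution_even_moments(1)[of 2] by (simp add: fact_numeral)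
  moreover have "sqrt r ^ 4 = r\<^sup>2" if "0 \<le> r" for r
    using power_mult[of "sqrt r" 2 2] that by simp
  ultimately show ?thesis
    using mv_normal_moment(2)[of u 4] factorized_nonneg[of u] by simp
qed

text \<open>Polarisation writes the product as a difference of squares of linear forms.\<close>

lemma mv_normal_cross_moment:
  "integrable (mv_normal 0 V) (\<lambda>x. (u \<bullet> x) * (v \<bullet> x))"
  "(\<integral>x. (u \<bullet> x) * (v \<bullet> x) \<partial>mv_normal 0 V) = u \<bullet> (V *v v)"
proof -
  have eq: "(u \<bullet> x) * (v \<bullet> x) = (((u + v) \<bullet> x)\<^sup>2 - ((u - v) \<bullet> x)\<^sup>2) / 4" for x
    by (simp add: inner_add_left inner_diff_left power2_eq_square algebra_simps)
  show "integrable (mv_normal 0 V) (\<lambda>x. (u \<bullet> x) * (v \<bullet> x))"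
    unfolding eq by (intro integrable_divide_zero Bochner_Integration.integrable_diff mv_normal_moment(1))
  show "(\<integral>x. (u \<bullet> x) * (v \<bullet> x) \<partial>mv_normal 0 V) = u \<bullet> (V *v v)"
    unfolding eq using factorized_symmetric[of u v]
    by (simp add: mv_normal_moment(1) mv_normal_moment_2)
      (simp add: matrix_vector_right_distrib
        matrix_vector_mult_diff_distrib inner_add_left inner_diff_left inner_add_right inner_diff_right)
qed

text \<open>Fourth-order polarisation: (r + s)^4 + (r - s)^4 = 2 r^4 + 12 r^2 s^2 + 2 s^4. If the
  forms are uncorrelated with variances a and b, both u + v and u - v have variance a + b, and (6 (a
  + b)^2 - 6 a^2 - 6 b^2) / 12 = a b. No independence of the two forms has to be
  established.\<close>

lemma mv_normal_square_product:
  "integrable (mv_normal 0 V) (\<lambda>x. (u \<bullet> x)\<^sup>2 * (v \<bullet> x)\<^sup>2)"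
  "u \<bullet> (V *v v) = 0 \<Longrightarrow>
    (\<integral>x. (u \<bullet> x)\<^sup>2 * (v \<bullet> x)\<^sup>2 \<partial>mv_normal 0 V) = (u \<bullet> (V *v u)) * (v \<bullet> (V *v v))"
proof -
  have eq: "(u \<bullet> x)\<^sup>2 * (v \<bullet> x)\<^sup>2 =
      (((u + v) \<bullet> x) ^ 4 + ((u - v) \<bullet> x) ^ 4 - 2 * (u \<bullet> x) ^ 4 - 2 * (v \<bullet> x) ^ 4) / 12" for x
    by (simp add: inner_add_left inner_diff_left) algebra
  show "integrable (mv_normal 0 V) (\<lambda>x. (u \<bullet> x)\<^sup>2 * (v \<bullet> x)\<^sup>2)"
    unfolding eq
    by (intro integrable_divide_zero Bochner_Integration.integrable_diff Bochner_Integration.integrable_add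
        integrable_mult_right mv_normal_moment(1))
  assume orth: "u \<bullet> (V *v v) = 0"
  then have orth': "v \<bullet> (V *v u) = 0" using factorized_symmetric by simp
  have q: "(u + v) \<bullet> (V *v (u + v)) = u \<bullet> (V *v u) + v \<bullet> (V *v v)"
    "(u - v) \<bullet> (V *v (u - v)) = u \<bullet> (V *v u) + v \<bullet> (V *v v)"
    using orth orth'
    by (simp_all add: matrix_vector_right_distrib matrix_vector_mult_diff_distrib
        inner_add_left inner_diff_left inner_add_right inner_diff_right)
  show "(\<integral>x. (u \<bullet> x)\<^sup>2 * (v \<bullet> x)\<^sup>2 \<partial>mv_normal 0 V) = (u \<bullet> (V *v u)) * (v \<bullet> (V *v v))"
    unfolding eq by (simp add: mv_normal_moment(1) mv_normal_moment_4 q) (simp add: power2_eq_square algebra_simps)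
qed

lemma power2_norm_eq_sum_axis: "(norm x)\<^sup>2 = (\<Sum>k\<in>UNIV. (axis k 1 \<bullet> x)\<^sup>2)" for x :: "real ^ 'n"
  unfolding power2_norm_eq_inner inner_axis' by (simp add: inner_vec_def power2_eq_square)

lemma mv_normal_norm_moments:
  "integrable (mv_normal 0 V) (\<lambda>x. (norm x)\<^sup>2)" "integrable (mv_normal 0 V) (\<lambda>x. (norm x) ^ 4)"
proof -
  show "integrable (mv_normal 0 V) (\<lambda>x. (norm x)\<^sup>2)"
    unfolding power2_norm_eq_sum_axis by (intro Bochner_Integration.integrable_sum mv_normal_moment(1))
  have eq: "(norm x) ^ 4 = (\<Sum>k\<in>UNIV. \<Sum>l\<in>UNIV. (axis k 1 \<bullet> x)\<^sup>2 * (axis l 1 \<bullet> x)\<^sup>2)" for x :: "real ^ 'p"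
    using power_mult[of "norm x" 2 2] unfolding power2_norm_eq_sum_axis
    by (simp add: power2_eq_square[of "sum _ _"] sum_product)
  show "integrable (mv_normal 0 V) (\<lambda>x. (norm x) ^ 4)"
    unfolding eq by (intro Bochner_Integration.integrable_sum mv_normal_square_product(1))
qed

end

text \<open>The factor chosen by \<open>SOME\<close> depends on V alone, so both sides use the same
  matrix.\<close>

lemma mv_normal_shift: "mv_normal m V = distr (mv_normal 0 V) borel (\<lambda>x. m + x)"
  unfolding mv_normal_def
  by (subst distr_distr) (auto simp: comp_def std_mv_normal_def intro!: measurable_affine[of 0, simplified])

section \<open>The discriminant direction as a function of averages\<close>

text \<open>A product rule in which the second factor need only be continuous: where f vanishes, f
  is of first order and g - g(x) tends to zero, so their product is negligible. This turns mere
  continuity of w into differentiability.\<close>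

lemma has_derivative_bilinear_at_zero:
  fixes f :: "'a :: real_normed_vector \<Rightarrow> 'b :: real_normed_vector"
    and g :: "'a \<Rightarrow> 'c :: real_normed_vector"
  assumes "bounded_bilinear p" and f: "(f has_derivative f') (at x)" and f0: "f x = 0"
    and g: "isCont g x"
  shows "((\<lambda>y. p (f y) (g y)) has_derivative (\<lambda>h. p (f' h) (g x))) (at x)"
proof -
  interpret p: bounded_bilinear p by fact
  have "((\<lambda>y. p (f y) (g y - g x)) has_derivative (\<lambda>_. 0)) (at x)"
    unfolding has_derivative_at_alt
  proof (intro conjI allI impI bounded_linear_zero)
    fix e :: real assume "0 < e"
    obtain K where K: "0 < K" "\<And>a b. norm (p a b) \<le> norm a * norm b * K"
      using p.pos_bounded by blast
    obtain C where C: "0 < C" "\<And>h. norm (f' h) \<le> norm h * C"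
      using bounded_linear.pos_bounded[OF has_derivative_bounded_linear[OF f]] by blast
    obtain d where d: "0 < d" "\<And>y. norm (y - x) < d \<Longrightarrow> norm (f y - f x - f' (y - x)) \<le> 1 * norm (y - x)"
      using f unfolding has_derivative_at_alt by (metis zero_less_one)
    \<comment> \<open>Near x, |f y| \<le> (C + 1) |y - x|, where C bounds the derivative and 1 the
      remainder; K is the constant of the bilinear map.\<close>
    define r where "r = e / ((C + 1) * K)"
    have "0 < r" using \<open>0 < e\<close> C(1) K(1) by (simp add: r_def)
    then obtain s where s: "0 < s" "\<And>y. norm (y - x) < s \<Longrightarrow> norm (g y - g x) < r"
      using g unfolding continuous_at_eps_delta dist_norm by blast
    show "\<exists>d>0. \<forall>y. norm (y - x) < d \<longrightarrow>
        norm (p (f y) (g y - g x) - p (f x) (g x - g x) - 0) \<le> e * norm (y - x)"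
    proof (intro exI conjI allI impI)
      show "0 < min d s" using d s by simp
      fix y assume y: "norm (y - x) < min d s"
      have "norm (f y) \<le> norm (f y - f x - f' (y - x)) + norm (f' (y - x))"
        using norm_triangle_ineq[of "f y - f x - f' (y - x)" "f' (y - x)"] f0 by simp
      also have "\<dots> \<le> norm (y - x) * (C + 1)"
        using d(2)[of y] C(2)[of "y - x"] y by (simp add: algebra_simps)
      finally have fy: "norm (f y) \<le> norm (y - x) * (C + 1)" .
      have "norm (p (f y) (g y - g x)) \<le> norm (f y) * norm (g y - g x) * K" by (rule K(2))
      also have "\<dots> \<le> (norm (y - x) * (C + 1)) * r * K"
        using fy s(2)[of y] y K(1) C(1) by (intro mult_right_mono mult_mono) auto
      also have "\<dots> = e * norm (y - x)" using C(1) K(1) by (simp add: r_def)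
      finally show "norm (p (f y) (g y - g x) - p (f x) (g x - g x) - 0) \<le> e * norm (y - x)"
        by (simp add: p.zero_right)
    qed
  qed
  moreover have "((\<lambda>y. p (f y) (g x)) has_derivative (\<lambda>h. p (f' h) (g x))) (at x)"
    using bounded_linear.has_derivative[OF p.bounded_linear_left f] .
  ultimately have "((\<lambda>y. p (f y) (g y - g x) + p (f y) (g x)) has_derivative (\<lambda>h. 0 + p (f' h) (g x))) (at x)"
    by (rule has_derivative_add)
  then show ?thesis by (simp add: p.diff_right)
qed

section \<open>Matrix-vector products, determinants and Cramer's rule\<close>

lemma bounded_bilinear_matrix_vector_mult: "bounded_bilinear ((*v) :: real ^ 'p ^ 'q \<Rightarrow> _)"
  unfolding bilinear_conv_bounded_bilinear[symmetric] bilinear_def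
  by (auto intro!: linearI simp: matrix_vector_right_distrib matrix_vector_mult_scaleR
      matrix_vector_mult_add_rdistrib scaleR_matrix_vector_assoc)

lemma continuous_det:
  fixes f :: "'a :: t2_space \<Rightarrow> real ^ 'p ^ 'p"
  assumes "\<And>i j. continuous F (\<lambda>x. f x $ i $ j)"
  shows "continuous F (\<lambda>x. det (f x))"
  unfolding det_def by (intro continuous_intros assms)

lemma borel_measurable_det:
  fixes f :: "'a \<Rightarrow> real ^ 'p ^ 'p"
  assumes "\<And>i j. (\<lambda>x. f x $ i $ j) \<in> borel_measurable M"
  shows "(\<lambda>x. det (f x)) \<in> borel_measurable M"
  unfolding det_def
  by (intro borel_measurable_sum borel_measurable_times borel_measurable_prod borel_measurable_const assms)

lemma borel_measurable_vec_lambda: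
  fixes f :: "'a \<Rightarrow> 'n :: finite \<Rightarrow> real"
  assumes "\<And>i. (\<lambda>x. f x i) \<in> borel_measurable M"
  shows "(\<lambda>x. \<chi> i. f x i) \<in> borel_measurable M"
  by (subst borel_measurable_euclidean_space)
     (auto simp: Basis_vec_def inner_axis intro: assms)

lemma continuous_vec_lambda:
  fixes f :: "'a :: t2_space \<Rightarrow> 'n :: finite \<Rightarrow> 'b :: topological_space"
  assumes "\<And>i. continuous F (\<lambda>x. f x i)"
  shows "continuous F (\<lambda>x. \<chi> i. f x i)"
  using assms unfolding continuous_def by (intro vec_tendstoI) simp

text \<open>A quotient of polynomials in the entries of S and b, so continuity and measurability can
  be checked entrywise. For a singular S total division gives 0, and the function stays measurable
  everywhere.\<close>

definition cramer_solution :: "real ^ 'p ^ 'p \<Rightarrow> real ^ 'p \<Rightarrow> real ^ 'p" where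
  "cramer_solution S b = (\<chi> k. det (\<chi> i j. if j = k then b $ i else S $ i $ j) / det S)"

lemma cramer_solution_iff: "det S \<noteq> 0 \<Longrightarrow> S *v x = b \<longleftrightarrow> x = cramer_solution S b"
  unfolding cramer_solution_def by (rule cramer)

lemma matrix_inv_inverse:
  fixes S :: "real ^ 'p ^ 'p"
  assumes "invertible S"
  shows "S ** matrix_inv S = mat 1" "matrix_inv S ** S = mat 1"
  using someI_ex[OF assms[unfolded invertible_def]] unfolding matrix_inv_def by auto

lemma matrix_inv_mult_vec:
  fixes S :: "real ^ 'p ^ 'p"
  assumes "invertible S"
  shows "matrix_inv S *v (S *v x) = x" "S *v (matrix_inv S *v x) = x"
  using assms by (simp_all add: matrix_vector_mul_assoc matrix_inv_inverse)

lemma matrix_inv_mult_eq_cramer_solution: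
  "invertible S \<Longrightarrow> matrix_inv S *v b = cramer_solution S b" for S :: "real ^ 'p ^ 'p"
  by (simp add: cramer_solution_iff[symmetric] matrix_inv_mult_vec invertible_det_nz[symmetric])

lemma continuous_cramer_solution:
  fixes S :: "'a :: t2_space \<Rightarrow> real ^ 'p ^ 'p"
  assumes S: "\<And>i j. isCont (\<lambda>x. S x $ i $ j) x" and b: "\<And>i. isCont (\<lambda>x. b x $ i) x"
    and "det (S x) \<noteq> 0"
  shows "isCont (\<lambda>x. cramer_solution (S x) (b x)) x"
  unfolding cramer_solution_def
proof (intro continuous_vec_lambda isCont_divide continuous_det)
  show "isCont (\<lambda>x. (\<chi> i j. if j = k then b x $ i else S x $ i $ j) $ i $ j) x" for i j k
    using S b by (cases "j = k") auto
qed (use assms in auto)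

lemma borel_measurable_cramer_solution:
  fixes S :: "'a \<Rightarrow> real ^ 'p ^ 'p"
  assumes S: "\<And>i j. (\<lambda>x. S x $ i $ j) \<in> borel_measurable M"
    and b: "\<And>i. (\<lambda>x. b x $ i) \<in> borel_measurable M"
  shows "(\<lambda>x. cramer_solution (S x) (b x)) \<in> borel_measurable M"
  unfolding cramer_solution_def
proof (intro borel_measurable_vec_lambda borel_measurable_divide borel_measurable_det S)
  show "(\<lambda>x. (\<chi> i j. if j = k then b x $ i else S x $ i $ j) $ i $ j) \<in> borel_measurable M" for i j k
    using S b by (cases "j = k") auto
qed

lemma outer_mult_vec: "outer u v *v w = (v \<bullet> w) *\<^sub>R u"
  by (simp add: outer_def vec_eq_iff matrix_vector_mult_def inner_vec_def sum_distrib_left ac_simps)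

lemma outer_nth: "outer u v $ i $ j = u $ i * v $ j"
  by (simp add: outer_def)

lemma norm_outer: "norm (outer u v) = norm u * norm v"
proof -
  have "(norm (outer u v))\<^sup>2 = (\<Sum>i\<in>UNIV. \<Sum>j\<in>UNIV. (u $ i * v $ j)\<^sup>2)"
    unfolding power2_norm_eq_inner by (simp add: inner_vec_def outer_def power2_eq_square)
  also have "\<dots> = (norm u)\<^sup>2 * (norm v)\<^sup>2"
    unfolding power2_norm_eq_inner
    by (simp add: inner_vec_def power2_eq_square sum_product ac_simps)
  finally show ?thesis by (metis norm_ge_zero mult_nonneg_nonneg power2_eq_imp_eq power_mult_distrib)
qed

section \<open>The estimator as a map of the statistic, and its derivative\<close>

text \<open>
  The statistic \<open>(a, b, c, Q)\<close> holds the averages over the sample of \<open>y\<close>, \<open>y \<epsilon>\<close>, \<open>(1 - y) \<epsilon>\<close> and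
  \<open>\<epsilon> \<epsilon>'\<close>, where \<open>\<epsilon>\<close> is \<open>x\<close> minus the mean of its group.
\<close>
type_synonym 'p stat = "real \<times> (real ^ 'p) \<times> (real ^ 'p) \<times> (real ^ 'p ^ 'p)"

definition stat_of :: "real ^ 'p \<Rightarrow> real \<Rightarrow> 'p::finite stat" where
  "stat_of e y = (y, y *\<^sub>R e, (1 - y) *\<^sub>R e, outer e e)"

definition stat_diff :: "real ^ 'p \<Rightarrow> 'p::finite stat \<Rightarrow> real ^ 'p" where
  "stat_diff \<delta> = (\<lambda>(a, b, c, Q). \<delta> + c /\<^sub>R (1 - a) - b /\<^sub>R a)"

text \<open>The pooled scatter divided by n: the uncentred second moment of the residuals minus the
  corrections for the two residual group means b / a and c / (1 - a).\<close>

definition stat_cov :: "'p::finite stat \<Rightarrow> real ^ 'p ^ 'p" where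
  "stat_cov = (\<lambda>(a, b, c, Q). Q - outer b b /\<^sub>R a - outer c c /\<^sub>R (1 - a))"

definition stat_w :: "real ^ 'p \<Rightarrow> 'p::finite stat \<Rightarrow> real ^ 'p" where
  "stat_w \<delta> T = cramer_solution (stat_cov T) (stat_diff \<delta> T)"

text \<open>The guards copy those of \<open>lda_direction_defined\<close>, so for n \<ge> 3 the two
  directions agree on every sample and no almost-sure argument about degenerate samples is
  needed.\<close>

definition stat_direction :: "real ^ 'p \<Rightarrow> real ^ 'p \<Rightarrow> 'p::finite stat \<Rightarrow> real ^ 'p" where
  "stat_direction d\<^sub>0 \<delta> T =
     (if fst T \<noteq> 0 \<and> 1 - fst T \<noteq> 0 \<and> det (stat_cov T) \<noteq> 0 \<and> stat_w \<delta> T \<noteq> 0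
      then stat_w \<delta> T /\<^sub>R norm (stat_w \<delta> T) else d\<^sub>0)"

lemma stat_cov_nth: "stat_cov T $ i $ j = snd (snd (snd T)) $ i $ j
    - inverse (fst T) * (fst (snd T) $ i * fst (snd T) $ j)
    - inverse (1 - fst T) * (fst (snd (snd T)) $ i * fst (snd (snd T)) $ j)"
  by (simp add: stat_cov_def outer_nth split: prod.splits)

lemma stat_diff_nth: "stat_diff \<delta> T $ i =
    \<delta> $ i + inverse (1 - fst T) * fst (snd (snd T)) $ i - inverse (fst T) * fst (snd T) $ i"
  by (simp add: stat_diff_def split: prod.splits)

lemma borel_measurable_stat_direction:
  "stat_direction d\<^sub>0 \<delta> \<in> borel_measurable borel"
proof -
  have fst1: "(\<lambda>T :: ('p :: finite) stat. fst T) \<in> borel_measurable borel"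
    by (intro borel_measurable_continuous_onI continuous_intros)
  have b: "(\<lambda>T :: ('p :: finite) stat. fst (snd T) $ i) \<in> borel_measurable borel" for i
    by (intro borel_measurable_continuous_onI continuous_intros)
  have c: "(\<lambda>T :: ('p :: finite) stat. fst (snd (snd T)) $ i) \<in> borel_measurable borel" for i
    by (intro borel_measurable_continuous_onI continuous_intros)
  have Q: "(\<lambda>T :: ('p :: finite) stat. snd (snd (snd T)) $ i $ j) \<in> borel_measurable borel" for i j
    by (intro borel_measurable_continuous_onI continuous_intros)
  note [measurable] = fst1 b c Q
  have S: "(\<lambda>T :: ('p :: finite) stat. stat_cov T $ i $ j) \<in> borel_measurable borel" for i j
    unfolding stat_cov_nth by measurable
  have D: "(\<lambda>T. stat_diff \<delta> T $ i) \<in> borel_measurable borel" for i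
    unfolding stat_diff_nth by measurable
  have [measurable]: "stat_w \<delta> \<in> borel_measurable borel"
    unfolding stat_w_def[abs_def] by (rule borel_measurable_cramer_solution[OF S D])
  have [measurable]: "(\<lambda>T :: ('p :: finite) stat. det (stat_cov T)) \<in> borel_measurable borel"
    by (rule borel_measurable_det[OF S])
  show ?thesis unfolding stat_direction_def[abs_def] by measurable
qed

lemma bounded_linear_stat_nth:
  "bounded_linear (\<lambda>T :: ('p :: finite) stat. fst (snd T) $ i)"
  "bounded_linear (\<lambda>T :: ('p :: finite) stat. fst (snd (snd T)) $ i)"
  "bounded_linear (\<lambda>T :: ('p :: finite) stat. snd (snd (snd T)) $ i $ j)"
proof -
  have b: "bounded_linear (\<lambda>T :: 'p stat. fst (snd T))" and c: "bounded_linear (\<lambda>T :: 'p stat. fst (snd (snd T)))"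
    and Q: "bounded_linear (\<lambda>T :: 'p stat. snd (snd (snd T)))"
    by (intro bounded_linear_intros)+
  note nth = bounded_linear_compose[OF bounded_linear_vec_nth]
  show "bounded_linear (\<lambda>T :: 'p stat. fst (snd T) $ i)" by (rule nth[OF b])
  show "bounded_linear (\<lambda>T :: 'p stat. fst (snd (snd T)) $ i)" by (rule nth[OF c])
  show "bounded_linear (\<lambda>T :: 'p stat. snd (snd (snd T)) $ i $ j)" by (rule nth[OF nth[OF Q]])
qed

text \<open>
  Since \<open>S(T) (w(T) - \<theta>) = d(T) - S(T) \<theta>\<close> and \<open>w\<close> is continuous, \<open>w\<close> has the same derivative as
  \<open>\<Sigma>\<^sup>-\<^sup>1 (d(T) - S(T) \<theta>)\<close>.
\<close>
lemma has_derivative_stat_w: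
  fixes V :: "real ^ 'p ^ 'p" and \<delta> \<theta> :: "real ^ 'p"
  assumes a: "0 < a" "a < 1" and V: "invertible V" and \<theta>: "\<theta> = matrix_inv V *v \<delta>"
  shows "(stat_w \<delta> has_derivative
      (\<lambda>(da, db, dc, dQ). matrix_inv V *v (dc /\<^sub>R (1 - a) - db /\<^sub>R a - dQ *v \<theta>)))
      (at (a, 0, 0, V))"
    and "stat_w \<delta> (a, 0, 0, V) = \<theta>"
    and "\<forall>\<^sub>F T in nhds (a, 0, 0, V). det (stat_cov T) \<noteq> 0"
proof -
  let ?T = "(a, 0, 0, V) :: 'p stat"
  have contS: "isCont (\<lambda>T. stat_cov T $ i $ j) ?T" for i j
    unfolding stat_cov_nth using a by (intro continuous_intros) auto
  have contD: "isCont (\<lambda>T. stat_diff \<delta> T $ i) ?T" for i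
    unfolding stat_diff_nth using a by (intro continuous_intros) auto
  have covT: "stat_cov ?T = V" and diffT: "stat_diff \<delta> ?T = \<delta>"
    by (simp_all add: vec_eq_iff stat_cov_nth stat_diff_nth)
  have detV: "det (stat_cov ?T) \<noteq> 0" using V by (simp add: covT invertible_det_nz)
  show wT: "stat_w \<delta> ?T = \<theta>"
    using V by (simp add: stat_w_def covT diffT \<theta> matrix_inv_mult_eq_cramer_solution)
  have contw: "isCont (stat_w \<delta>) ?T"
    unfolding stat_w_def[abs_def] using contS contD detV by (rule continuous_cramer_solution)
  have "isCont (\<lambda>T. det (stat_cov T)) ?T" using contS by (rule continuous_det)
  then have "((\<lambda>T. det (stat_cov T)) \<longlongrightarrow> det (stat_cov ?T)) (nhds ?T)"
    unfolding continuous_at tendsto_at_iff_tendsto_nhds[of "\<lambda>T. det (stat_cov T)"] .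
  then show ev: "\<forall>\<^sub>F T in nhds ?T. det (stat_cov T) \<noteq> 0"
    using detV by (rule tendsto_imp_eventually_ne)
  define h where "h T = stat_diff \<delta> T - stat_cov T *v \<theta>" for T
  define h' where "h' = (\<lambda>(da :: real, db :: real ^ 'p, dc, dQ :: real ^ 'p ^ 'p). dc /\<^sub>R (1 - a) - db /\<^sub>R a - dQ *v \<theta>)"
  \<comment> \<open>Rearranged so that every term containing a is a continuous coefficient times b
    or c.\<close>
  have h_eq: "h T = \<delta> + fst (snd (snd T)) /\<^sub>R (1 - fst T) - fst (snd T) /\<^sub>R fst T - snd (snd (snd T)) *v \<theta>
      + ((fst (snd T) \<bullet> \<theta>) / fst T) *\<^sub>R fst (snd T)
      + ((fst (snd (snd T)) \<bullet> \<theta>) / (1 - fst T)) *\<^sub>R fst (snd (snd T))" for T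
    by (simp add: h_def stat_diff_def stat_cov_def matrix_vector_mult_diff_rdistrib outer_mult_vec
        scaleR_matrix_vector_assoc[symmetric] divide_inverse_commute split: prod.splits)
  have dQ: "((\<lambda>T :: ('p :: finite) stat. snd (snd (snd T)) *v \<theta>) has_derivative (\<lambda>T. snd (snd (snd T)) *v \<theta>)) (at ?T)"
    by (rule bounded_linear.has_derivative[OF bounded_bilinear.bounded_linear_left[OF bounded_bilinear_matrix_vector_mult]])
       (auto intro!: derivative_eq_intros)
  \<comment> \<open>For a linear f that is zero at the base point, the coefficient only has to be
    continuous and is frozen at its value there. For the two quadratic terms that value is
    0.\<close>
  have vanish: "((\<lambda>T. g T *\<^sub>R f T) has_derivative (\<lambda>T. g ?T *\<^sub>R f T)) (at ?T)"
    if "bounded_linear f" "f ?T = 0" "isCont g ?T" for f :: "'p stat \<Rightarrow> real ^ 'p" and g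
    by (rule has_derivative_bilinear_at_zero[OF bounded_bilinear.flip[OF bounded_bilinear_scaleR]])
       (use that in \<open>auto intro: bounded_linear_imp_has_derivative\<close>)
  have b: "bounded_linear (\<lambda>T :: 'p stat. fst (snd T))" and c: "bounded_linear (\<lambda>T :: 'p stat. fst (snd (snd T)))"
    by (intro bounded_linear_intros)+
  have bc_terms:
    "((\<lambda>T :: 'p stat. fst (snd (snd T)) /\<^sub>R (1 - fst T)) has_derivative (\<lambda>T. fst (snd (snd T)) /\<^sub>R (1 - a))) (at ?T)"
    "((\<lambda>T :: 'p stat. fst (snd T) /\<^sub>R fst T) has_derivative (\<lambda>T. fst (snd T) /\<^sub>R a)) (at ?T)"
    "((\<lambda>T :: 'p stat. ((fst (snd T) \<bullet> \<theta>) / fst T) *\<^sub>R fst (snd T)) has_derivative (\<lambda>T. 0)) (at ?T)"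
    "((\<lambda>T :: 'p stat. ((fst (snd (snd T)) \<bullet> \<theta>) / (1 - fst T)) *\<^sub>R fst (snd (snd T))) has_derivative (\<lambda>T. 0)) (at ?T)"
    using vanish[OF c, of "\<lambda>T. inverse (1 - fst T)"] vanish[OF b, of "\<lambda>T. inverse (fst T)"]
      vanish[OF b, of "\<lambda>T. (fst (snd T) \<bullet> \<theta>) / fst T"]
      vanish[OF c, of "\<lambda>T. (fst (snd (snd T)) \<bullet> \<theta>) / (1 - fst T)"] a
    by (simp_all add: continuous_intros)
  have dh: "(h has_derivative h') (at ?T)"
    unfolding h_eq[abs_def]
    by (rule has_derivative_eq_rhs, (rule has_derivative_add has_derivative_diff has_derivative_const bc_terms dQ)+)
       (auto simp: h'_def fun_eq_iff)
  have "\<exists>S'. (stat_cov has_derivative S') (at ?T)"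
  proof -
    have "(\<lambda>T. stat_cov T $ i $ j) differentiable (at ?T)" for i j
    proof -
      note lin = bounded_linear_stat_nth[THEN bounded_linear_imp_differentiable]
      have "(fst :: 'p stat \<Rightarrow> real) differentiable (at ?T)"
        by (rule bounded_linear_imp_differentiable[OF bounded_linear_fst])
      then show ?thesis
        unfolding stat_cov_nth using a by (intro derivative_intros lin) auto
    qed
    then have "stat_cov differentiable (at ?T)"
      by (subst differentiable_componentwise_within) (auto simp: Basis_vec_def inner_axis)
    then show ?thesis by (simp add: differentiable_def)
  qed
  then obtain S' where S': "(stat_cov has_derivative S') (at ?T)" ..
  \<comment> \<open>Both factors vanish at the base point; one is differentiable and the other
    continuous there, so the product is of smaller order.\<close>
  have small: "((\<lambda>T. (stat_cov T - V) *v (stat_w \<delta> T - \<theta>)) has_derivative (\<lambda>T. 0)) (at ?T)"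
  proof -
    have "((\<lambda>T. stat_cov T - V) has_derivative (\<lambda>T. S' T)) (at ?T)"
      using S' by (auto intro!: derivative_eq_intros)
    moreover have "isCont (\<lambda>T. stat_w \<delta> T - \<theta>) ?T" using contw by (intro continuous_intros)
    ultimately show ?thesis
      using has_derivative_bilinear_at_zero[OF bounded_bilinear_matrix_vector_mult, of "\<lambda>T. stat_cov T - V" S' ?T
          "\<lambda>T. stat_w \<delta> T - \<theta>"]
      by (simp add: covT wT)
  qed
  \<comment> \<open>Wherever S is regular, S w = d gives V (w - \<theta>) = h - (S - V) (w -
    \<theta>). The function differentiated here therefore equals w near the base point.\<close>
  have "((\<lambda>T. \<theta> + matrix_inv V *v (h T - (stat_cov T - V) *v (stat_w \<delta> T - \<theta>)))
      has_derivative (\<lambda>T. matrix_inv V *v h' T)) (at ?T)"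
    by (rule has_derivative_eq_rhs[OF has_derivative_add[OF has_derivative_const
          bounded_linear.has_derivative[OF matrix_vector_mul_bounded_linear has_derivative_diff[OF dh small]]]]) simp
  then have "(stat_w \<delta> has_derivative (\<lambda>T. matrix_inv V *v h' T)) (at ?T)"
  proof (rule has_derivative_transform_eventually)
    have eq: "\<theta> + matrix_inv V *v (h T - (stat_cov T - V) *v (stat_w \<delta> T - \<theta>)) = stat_w \<delta> T"
      if "det (stat_cov T) \<noteq> 0" for T
    proof -
      have "stat_cov T *v stat_w \<delta> T = stat_diff \<delta> T"
        using that by (simp add: stat_w_def cramer_solution_iff)
      then have "h T - (stat_cov T - V) *v (stat_w \<delta> T - \<theta>) = V *v (stat_w \<delta> T - \<theta>)"
        by (simp add: h_def matrix_vector_mult_diff_rdistrib matrix_vector_mult_diff_distrib)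
      then show ?thesis using V by (simp add: matrix_inv_mult_vec)
    qed
    show "\<forall>\<^sub>F T in at ?T. \<theta> + matrix_inv V *v (h T - (stat_cov T - V) *v (stat_w \<delta> T - \<theta>)) = stat_w \<delta> T"
      using ev unfolding eventually_at_filter by (rule eventually_mono) (simp add: eq)
    show "\<theta> + matrix_inv V *v (h ?T - (stat_cov ?T - V) *v (stat_w \<delta> ?T - \<theta>)) = stat_w \<delta> ?T"
      using detV by (rule eq)
  qed simp
  then show "(stat_w \<delta> has_derivative
      (\<lambda>(da, db, dc, dQ). matrix_inv V *v (dc /\<^sub>R (1 - a) - db /\<^sub>R a - dQ *v \<theta>))) (at ?T)"
    by (rule has_derivative_eq_rhs) (auto simp: h'_def fun_eq_iff)
qed

lemma has_derivative_normalize: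
  fixes w :: "real ^ 'p"
  assumes "w \<noteq> 0"
  shows "((\<lambda>w. w /\<^sub>R norm w) has_derivative
      (\<lambda>v. ((mat 1 - outer w w /\<^sub>R (norm w)\<^sup>2) *v v) /\<^sub>R norm w)) (at w)"
proof -
  have "((\<lambda>w. w /\<^sub>R norm w) has_derivative
      (\<lambda>v. inverse (norm w) *\<^sub>R v + (- (inverse (norm w) * (sgn w \<bullet> v) * inverse (norm w))) *\<^sub>R w)) (at w)"
    using assms by (auto intro!: derivative_eq_intros has_derivative_norm simp: fun_eq_iff inner_commute)
  then show ?thesis
    by (rule has_derivative_eq_rhs)
       (simp add: fun_eq_iff matrix_vector_mult_diff_rdistrib outer_mult_vec sgn_div_norm
         scaleR_matrix_vector_assoc[symmetric] scaleR_diff_right power2_eq_square)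
qed

text \<open>All guards hold in a neighbourhood of the base point, so there the direction is the
  normalised w whatever the default \<open>d\<^sub>0\<close>; the chain rule does the rest.\<close>

lemma has_derivative_stat_direction:
  fixes V :: "real ^ 'p ^ 'p" and \<delta> \<theta> :: "real ^ 'p"
  assumes a: "0 < a" "a < 1" and V: "invertible V" and \<theta>: "\<theta> = matrix_inv V *v \<delta>" and "\<theta> \<noteq> 0"
  shows "(stat_direction d\<^sub>0 \<delta> has_derivative
      (\<lambda>(da, db, dc, dQ). ((mat 1 - outer \<theta> \<theta> /\<^sub>R (norm \<theta>)\<^sup>2) *v
         (matrix_inv V *v (dc /\<^sub>R (1 - a) - db /\<^sub>R a - dQ *v \<theta>))) /\<^sub>R norm \<theta>))
      (at (a, 0, 0, V))"
    and "stat_direction d\<^sub>0 \<delta> (a, 0, 0, V) = \<theta> /\<^sub>R norm \<theta>"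
proof -
  let ?T = "(a, 0, 0, V) :: 'p stat"
  note w = has_derivative_stat_w[OF assms(1-4)]
  have d: "((\<lambda>T. stat_w \<delta> T /\<^sub>R norm (stat_w \<delta> T)) has_derivative
      (\<lambda>(da, db, dc, dQ). ((mat 1 - outer \<theta> \<theta> /\<^sub>R (norm \<theta>)\<^sup>2) *v
         (matrix_inv V *v (dc /\<^sub>R (1 - a) - db /\<^sub>R a - dQ *v \<theta>))) /\<^sub>R norm \<theta>)) (at ?T)"
    using has_derivative_compose[OF w(1), of "\<lambda>w. w /\<^sub>R norm w"] has_derivative_normalize[OF \<open>\<theta> \<noteq> 0\<close>] w(2)
    by (simp add: case_prod_unfold)
  have "(stat_w \<delta> \<longlongrightarrow> stat_w \<delta> ?T) (nhds ?T)"
    using has_derivative_continuous[OF w(1)] by (simp only: continuous_at tendsto_at_iff_tendsto_nhds)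
  then have "(stat_w \<delta> \<longlongrightarrow> \<theta>) (nhds ?T)" by (simp only: w(2))
  then have w0: "\<forall>\<^sub>F T in nhds ?T. stat_w \<delta> T \<noteq> 0"
    using \<open>\<theta> \<noteq> 0\<close> by (rule tendsto_imp_eventually_ne)
  have "isCont fst ?T" by (intro continuous_intros)
  then have fst_lim: "(fst \<longlongrightarrow> a) (nhds ?T)"
    unfolding continuous_at tendsto_at_iff_tendsto_nhds[of fst] by simp
  have "\<forall>\<^sub>F T in nhds ?T. fst T \<noteq> 0" "\<forall>\<^sub>F T in nhds ?T. fst T \<noteq> 1"
    by (rule tendsto_imp_eventually_ne[OF fst_lim]; use a in simp)+
  with w0 w(3) have ev: "\<forall>\<^sub>F T in nhds ?T. stat_w \<delta> T /\<^sub>R norm (stat_w \<delta> T) = stat_direction d\<^sub>0 \<delta> T"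
    by eventually_elim (simp add: stat_direction_def)
  note at_T = eventually_nhds_x_imp_x[OF ev]
  show "stat_direction d\<^sub>0 \<delta> ?T = \<theta> /\<^sub>R norm \<theta>"
    using at_T unfolding w(2) by (rule sym)
  show "(stat_direction d\<^sub>0 \<delta> has_derivative
      (\<lambda>(da, db, dc, dQ). ((mat 1 - outer \<theta> \<theta> /\<^sub>R (norm \<theta>)\<^sup>2) *v
         (matrix_inv V *v (dc /\<^sub>R (1 - a) - db /\<^sub>R a - dQ *v \<theta>))) /\<^sub>R norm \<theta>))
      (at ?T)"
    using d
  proof (rule has_derivative_transform_eventually)
    show "\<forall>\<^sub>F T in at ?T. stat_w \<delta> T /\<^sub>R norm (stat_w \<delta> T) = stat_direction d\<^sub>0 \<delta> T"
      using ev unfolding eventually_at_filter by (rule eventually_mono) simp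
  qed (simp_all add: at_T)
qed

section \<open>Exact reduction of the estimator to averages\<close>

lemma weighted_scatter:
  fixes e :: "nat \<Rightarrow> real ^ 'p" and w :: "nat \<Rightarrow> real"
  assumes "W = (\<Sum>i\<in>I. w i)" "W \<noteq> 0" "B = (\<Sum>i\<in>I. w i *\<^sub>R e i)"
  shows "(\<Sum>i\<in>I. w i *\<^sub>R outer (e i - B /\<^sub>R W) (e i - B /\<^sub>R W)) =
    (\<Sum>i\<in>I. w i *\<^sub>R outer (e i) (e i)) - outer B B /\<^sub>R W"
proof -
  \<comment> \<open>The parallel axis identity, entry by entry: each cross term subtracts B_k B_l /
    W and the last term gives one of them back.\<close>
  have "(\<Sum>i\<in>I. w i * ((e i $ k - B $ k / W) * (e i $ l - B $ l / W))) =
      (\<Sum>i\<in>I. w i * (e i $ k * e i $ l)) - B $ k * B $ l / W" for k l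
  proof -
    have Bn: "B $ k = (\<Sum>i\<in>I. w i * e i $ k)" for k by (simp add: assms(3))
    have "(\<Sum>i\<in>I. w i * ((e i $ k - B $ k / W) * (e i $ l - B $ l / W))) =
        (\<Sum>i\<in>I. w i * (e i $ k * e i $ l) - (w i * e i $ k) * (B $ l / W)
          - (w i * e i $ l) * (B $ k / W) + w i * (B $ k / W * (B $ l / W)))"
      by (intro sum.cong) (auto simp: algebra_simps)
    also have "\<dots> = (\<Sum>i\<in>I. w i * (e i $ k * e i $ l)) - B $ k * (B $ l / W)
          - B $ l * (B $ k / W) + W * (B $ k / W * (B $ l / W))"
      by (simp only: sum.distrib sum_subtractf sum_distrib_right[symmetric] Bn[symmetric] assms(1)[symmetric])
    finally show ?thesis using \<open>W \<noteq> 0\<close> by simp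
  qed
  then show ?thesis by (simp add: vec_eq_iff outer_nth divide_inverse_commute)
qed

lemma sum_stat_of: "(\<Sum>i\<in>I. stat_of (e i) (y i)) =
    (\<Sum>i\<in>I. y i, \<Sum>i\<in>I. y i *\<^sub>R e i, \<Sum>i\<in>I. (1 - y i) *\<^sub>R e i, \<Sum>i\<in>I. outer (e i) (e i))"
  by (simp add: prod_eq_iff fst_sum snd_sum stat_of_def)

text \<open>For a binary label this subtracts the mean of the observation's own group; the affine
  form in y keeps the map continuous in x and y jointly.\<close>

definition residual :: "real ^ 'p \<Rightarrow> real ^ 'p \<Rightarrow> real ^ 'p \<Rightarrow> real \<Rightarrow> real ^ 'p" where
  "residual \<mu>\<^sub>1 \<mu>\<^sub>2 x y = x - (y *\<^sub>R \<mu>\<^sub>1 + (1 - y) *\<^sub>R \<mu>\<^sub>2)"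

lemma matrix_inv_scaleR_mult_vec:
  fixes S :: "real ^ 'p ^ 'p"
  assumes "k \<noteq> 0" "det S \<noteq> 0"
  shows "invertible (k *\<^sub>R S)" and "matrix_inv (k *\<^sub>R S) *v b = cramer_solution S b /\<^sub>R k"
proof -
  have "invertible S" using assms(2) by (simp add: invertible_det_nz)
  then show inv: "invertible (k *\<^sub>R S)" by (rule scalar_invertible[OF assms(1)])
  have "S *v cramer_solution S b = b" using assms(2) by (simp add: cramer_solution_iff)
  then have "(k *\<^sub>R S) *v (cramer_solution S b /\<^sub>R k) = b"
    using assms(1) by (simp add: scaleR_matrix_vector_assoc[symmetric] matrix_vector_mult_scaleR)
  with matrix_inv_mult_vec(1)[OF inv, of "cramer_solution S b /\<^sub>R k"]
  show "matrix_inv (k *\<^sub>R S) *v b = cramer_solution S b /\<^sub>R k" by simp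
qed

text \<open>An observation and its group mean are shifted by the same vector, so the scatter depends
  on the residuals only, while the difference of the group means retains the shift
  \<open>\<mu>\<^sub>2 - \<mu>\<^sub>1\<close>.\<close>

lemma lda_direction_eq_stat_direction:
  fixes x :: "nat \<Rightarrow> real ^ 'p" and \<mu>\<^sub>1 \<mu>\<^sub>2 :: "real ^ 'p"
  assumes n: "3 \<le> n" and y: "\<And>i. y i \<in> {0, 1 :: real}"
  defines "e \<equiv> \<lambda>i. residual \<mu>\<^sub>1 \<mu>\<^sub>2 (x i) (y i)"
  shows "lda_direction d\<^sub>0 n x y =
    stat_direction d\<^sub>0 (\<mu>\<^sub>2 - \<mu>\<^sub>1) ((\<Sum>i<n. stat_of (e i) (y i)) /\<^sub>R real n)"
proof -
  define n1 where "n1 = (\<Sum>i<n. y i)"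
  define n2 where "n2 = (\<Sum>i<n. 1 - y i)"
  define B where "B = (\<Sum>i<n. y i *\<^sub>R e i)"
  define C where "C = (\<Sum>i<n. (1 - y i) *\<^sub>R e i)"
  define Q where "Q = (\<Sum>i<n. outer (e i) (e i))"
  define T where "T = (n1 / n, B /\<^sub>R real n, C /\<^sub>R real n, Q /\<^sub>R real n)"
  have T: "(\<Sum>i<n. stat_of (e i) (y i)) /\<^sub>R real n = T"
    by (simp add: sum_stat_of T_def n1_def B_def C_def Q_def divide_inverse_commute)
  have n0: "real n \<noteq> 0" using n by simp
  have n12: "1 - n1 / n = n2 / n"
    using n0 by (simp add: n1_def n2_def sum_subtractf field_simps)
  have fstT: "fst T \<noteq> 0 \<longleftrightarrow> n1 \<noteq> 0" "1 - fst T \<noteq> 0 \<longleftrightarrow> n2 \<noteq> 0"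
    using n0 by (simp_all add: T_def n12)
  show ?thesis
  proof (cases "n1 \<noteq> 0 \<and> n2 \<noteq> 0")
    case False
    then show ?thesis
      using fstT unfolding T lda_direction_def lda_direction_defined_def stat_direction_def
      by (auto simp: n1_def n2_def)
  next
    case True
    have yx: "y i *\<^sub>R x i = y i *\<^sub>R e i + y i *\<^sub>R \<mu>\<^sub>1"
      "(1 - y i) *\<^sub>R x i = (1 - y i) *\<^sub>R e i + (1 - y i) *\<^sub>R \<mu>\<^sub>2" for i
      using y[of i] by (auto simp: e_def residual_def)
    have m1: "group_mean1 n x y = \<mu>\<^sub>1 + B /\<^sub>R n1"
      using True by (simp add: group_mean1_def yx sum.distrib B_def n1_def scaleR_sum_left[symmetric] scaleR_add_right)
    have m2: "group_mean2 n x y = \<mu>\<^sub>2 + C /\<^sub>R n2"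
      using True unfolding group_mean2_def yx
      by (simp add: sum.distrib C_def n2_def scaleR_sum_left[symmetric] scaleR_add_right)
    have d: "stat_diff (\<mu>\<^sub>2 - \<mu>\<^sub>1) T = group_mean2 n x y - group_mean1 n x y"
      using n0 by (simp add: m1 m2 stat_diff_def T_def n12 field_simps)
    have out1: "y i *\<^sub>R outer (x i - group_mean1 n x y) (x i - group_mean1 n x y) =
        y i *\<^sub>R outer (e i - B /\<^sub>R n1) (e i - B /\<^sub>R n1)" for i
      using y[of i] by (auto simp: e_def residual_def m1 algebra_simps)
    have out2: "(1 - y i) *\<^sub>R outer (x i - group_mean2 n x y) (x i - group_mean2 n x y) =
        (1 - y i) *\<^sub>R outer (e i - C /\<^sub>R n2) (e i - C /\<^sub>R n2)" for i
      using y[of i] by (auto simp: e_def residual_def m2 algebra_simps)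
    \<comment> \<open>The weights y_i and 1 - y_i add up to 1, so the two uncentred second moments
      merge into Q.\<close>
    have "(\<Sum>i<n. y i *\<^sub>R outer (e i - B /\<^sub>R n1) (e i - B /\<^sub>R n1)) +
        (\<Sum>i<n. (1 - y i) *\<^sub>R outer (e i - C /\<^sub>R n2) (e i - C /\<^sub>R n2)) =
        Q - outer B B /\<^sub>R n1 - outer C C /\<^sub>R n2"
      using weighted_scatter[of n1 y "{..<n}" B e] weighted_scatter[of n2 "\<lambda>i. 1 - y i" "{..<n}" C e] True
      by (simp add: n1_def n2_def B_def C_def Q_def sum.distrib[symmetric] scaleR_add_left[symmetric] add_diff_eq
          diff_add_eq diff_diff_eq2)
    also have "\<dots> = real n *\<^sub>R stat_cov T"
      using n0 True by (simp add: vec_eq_iff stat_cov_nth T_def n12 outer_nth field_simps)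
    finally have S: "pooled_cov n x y = (real n / (real n - 2)) *\<^sub>R stat_cov T"
      unfolding pooled_cov_def out1 out2 by simp
    \<comment> \<open>Here n \<ge> 3 matters: k is positive, and a positive factor leaves the
      direction of w unchanged.\<close>
    define k where "k = real n / (real n - 2)"
    have k: "k > 0" using n by (simp add: k_def)
    have Sk: "pooled_cov n x y = k *\<^sub>R stat_cov T" using S by (simp add: k_def)
    show ?thesis
    proof (cases "det (stat_cov T) = 0")
      case det0: True
      have "\<not> invertible (pooled_cov n x y)"
      proof
        assume "invertible (pooled_cov n x y)"
        then have "det (pooled_cov n x y) \<noteq> 0" by (simp add: invertible_det_nz)
        from matrix_inv_scaleR_mult_vec(1)[OF _ this, of "1 / k"] k
        have "invertible (stat_cov T)" by (simp add: Sk)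
        with det0 show False by (simp add: invertible_det_nz)
      qed
      with det0 show ?thesis
        unfolding T lda_direction_def lda_direction_defined_def stat_direction_def by simp
    next
      case det1: False
      have k0: "k \<noteq> 0" using k by simp
      have inv: "invertible (pooled_cov n x y)"
        unfolding Sk by (rule matrix_inv_scaleR_mult_vec(1)[OF k0 det1])
      have w: "lda_w n x y = stat_w (\<mu>\<^sub>2 - \<mu>\<^sub>1) T /\<^sub>R k"
        unfolding lda_w_def Sk stat_w_def d by (rule matrix_inv_scaleR_mult_vec(2)[OF k0 det1])
      have "lda_direction_defined n x y \<longleftrightarrow> stat_w (\<mu>\<^sub>2 - \<mu>\<^sub>1) T \<noteq> 0"
        using True inv k n by (simp add: lda_direction_defined_def w n1_def n2_def)
      moreover have "lda_w n x y /\<^sub>R norm (lda_w n x y) = stat_w (\<mu>\<^sub>2 - \<mu>\<^sub>1) T /\<^sub>R norm (stat_w (\<mu>\<^sub>2 - \<mu>\<^sub>1) T)"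
        using k by (simp add: w)
      ultimately show ?thesis
        using True det1 fstT unfolding T lda_direction_def stat_direction_def by simp
    qed
  qed
qed

text \<open>With at most one observation some group is empty, and n = 2 is excluded by the divisor n
  - 2. The value is needed since convergence in distribution demands measurability for every
  n.\<close>

lemma lda_direction_small_sample:
  assumes "n < 3" and y: "\<And>i. y i \<in> {0, 1 :: real}"
  shows "lda_direction d\<^sub>0 n x y = d\<^sub>0"
proof -
  consider "n = 0" | "n = 1" | "n = 2" using assms(1) by linarith
  then have "\<not> lda_direction_defined n x y"
    by cases (use y[of 0] in \<open>auto simp: lda_direction_defined_def\<close>)
  then show ?thesis by (simp add: lda_direction_def)
qed

section \<open>Law of the residual and its independence of the label\<close>

context prob_space
begin

lemma prob_split_binary:
  assumes [measurable]: "y \<in> borel_measurable M" "Measurable.pred M P"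
    and y: "\<And>\<omega>. \<omega> \<in> space M \<Longrightarrow> y \<omega> \<in> {0, 1 :: real}" and [measurable]: "B \<in> sets borel"
  shows "prob {\<omega> \<in> space M. P \<omega> \<and> y \<omega> \<in> B} = (\<Sum>c\<in>{0, 1} \<inter> B. prob {\<omega> \<in> space M. P \<omega> \<and> y \<omega> = c})"
proof -
  have "{\<omega> \<in> space M. P \<omega> \<and> y \<omega> \<in> B} = (\<Union>c\<in>{0, 1} \<inter> B. {\<omega> \<in> space M. P \<omega> \<and> y \<omega> = c})"
    using y by auto
  moreover have "prob \<dots> = (\<Sum>c\<in>{0, 1} \<inter> B. prob {\<omega> \<in> space M. P \<omega> \<and> y \<omega> = c})"
    by (intro finite_measure_finite_Union) (auto simp: disjoint_family_on_def)
  ultimately show ?thesis by simp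
qed

text \<open>Given either label, the residual has the same law N(0, V), whence independence. The test
  functions h and k bring the vector and the label into the one type that \<open>indep_var\<close>
  relates.\<close>

lemma two_group_residual_law:
  fixes x :: "'a \<Rightarrow> real ^ 'p" and \<mu>\<^sub>1 \<mu>\<^sub>2 :: "real ^ 'p"
  assumes mix: "two_group_normal_mixture M x y \<alpha> \<mu>\<^sub>1 \<mu>\<^sub>2 V"
  defines "e \<equiv> \<lambda>\<omega>. residual \<mu>\<^sub>1 \<mu>\<^sub>2 (x \<omega>) (y \<omega>)"
  shows "e \<in> borel_measurable M" and "y \<in> borel_measurable M"
    and "distr M borel e = mv_normal 0 V"
    and "\<And>(h :: real ^ 'p \<Rightarrow> real) (k :: real \<Rightarrow> real). h \<in> borel_measurable borel \<Longrightarrow> k \<in> borel_measurable borel \<Longrightarrow>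
      indep_var borel (\<lambda>\<omega>. h (e \<omega>)) borel (\<lambda>\<omega>. k (y \<omega>))"
    and "distr M (borel \<Otimes>\<^sub>M borel) (\<lambda>\<omega>. (e \<omega>, y \<omega>)) =
      mv_normal 0 V \<Otimes>\<^sub>M distr (measure_pmf (bernoulli_pmf \<alpha>)) borel of_bool"
proof -
  let ?N = "mv_normal 0 V :: (real ^ 'p) measure"
  interpret N: prob_space ?N by (rule prob_space_mv_normal)
  have setsN: "sets ?N = sets borel" by (simp add: mv_normal_def)
  have [measurable]: "x \<in> borel_measurable M"
    and [measurable]: "y \<in> borel_measurable M"
    and y01: "\<And>\<omega>. \<omega> \<in> space M \<Longrightarrow> y \<omega> \<in> {0, 1}"
    and ydistr: "distr M borel y = distr (measure_pmf (bernoulli_pmf \<alpha>)) borel of_bool"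
    and cond: "\<And>c B. c \<in> {0, 1} \<Longrightarrow> B \<in> sets borel \<Longrightarrow>
        \<P>(\<omega> in M. x \<omega> \<in> B \<bar> y \<omega> = c) = measure (mv_normal (c *\<^sub>R \<mu>\<^sub>1 + (1 - c) *\<^sub>R \<mu>\<^sub>2) V) B"
    using mix by (auto simp: two_group_normal_mixture_def)
  show "y \<in> borel_measurable M" by fact
  show e_meas[measurable]: "e \<in> borel_measurable M" unfolding e_def residual_def by measurable
  \<comment> \<open>On the event y = c the residual is x minus a fixed vector, so the conditional
    law of x applies. A label of probability zero gives no information on that law, but then both
    sides vanish.\<close>
  have atom: "prob {\<omega> \<in> space M. e \<omega> \<in> A \<and> y \<omega> = c} = N.prob A * prob {\<omega> \<in> space M. y \<omega> = c}"
    if c: "c \<in> {0, 1}" and A[measurable]: "A \<in> sets borel" for c A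
  proof (cases "prob {\<omega> \<in> space M. y \<omega> = c} = 0")
    case True
    have "prob {\<omega> \<in> space M. e \<omega> \<in> A \<and> y \<omega> = c} \<le> prob {\<omega> \<in> space M. y \<omega> = c}"
      by (intro finite_measure_mono) auto
    with True show ?thesis by (simp add: measure_le_0_iff)
  next
    case False
    define m where "m = c *\<^sub>R \<mu>\<^sub>1 + (1 - c) *\<^sub>R \<mu>\<^sub>2"
    define B where "B = {v. v - m \<in> A}"
    have B: "B \<in> sets borel"
    proof -
      have "B = (\<lambda>v. v - m) -` A \<inter> space borel" by (auto simp: B_def)
      also have "\<dots> \<in> sets borel" by (rule measurable_sets[OF _ A]) simp
      finally show ?thesis .
    qed
    have "prob {\<omega> \<in> space M. e \<omega> \<in> A \<and> y \<omega> = c} = prob {\<omega> \<in> space M. x \<omega> \<in> B \<and> y \<omega> = c}"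
      by (rule arg_cong[where f = prob]) (auto simp: B_def m_def e_def residual_def)
    also have "\<dots> = measure (mv_normal m V) B * prob {\<omega> \<in> space M. y \<omega> = c}"
      using cond[OF c B] False by (simp add: cond_prob_def m_def field_simps)
    also have "measure (mv_normal m V) B = N.prob A"
    proof -
      have "measure (mv_normal m V) B = N.prob ((\<lambda>v. m + v) -` B \<inter> space ?N)"
        by (subst mv_normal_shift, rule measure_distr) (use B in \<open>auto simp: measurable_cong_sets[OF setsN refl]\<close>)
      also have "(\<lambda>v. m + v) -` B \<inter> space ?N = A"
        using sets_eq_imp_space_eq[OF setsN] by (auto simp: B_def)
      finally show ?thesis .
    qed
    finally show ?thesis .
  qed
  \<comment> \<open>Summing over the at most two labels in B extends the product formula to
    rectangles; B = UNIV then yields the law of the residual.\<close>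
  have rect: "prob {\<omega> \<in> space M. e \<omega> \<in> A \<and> y \<omega> \<in> B} = N.prob A * prob {\<omega> \<in> space M. y \<omega> \<in> B}"
    if [measurable]: "A \<in> sets borel" "B \<in> sets borel" for A B
    using prob_split_binary[of y "\<lambda>\<omega>. e \<omega> \<in> A" B] prob_split_binary[of y "\<lambda>\<omega>. True" B] y01
    by (simp add: atom sum_distrib_left)
  show e_law: "distr M borel e = ?N"
  proof (rule measure_eqI)
    fix A assume "A \<in> sets (distr M borel e)"
    then have A[measurable]: "A \<in> sets borel" by simp
    have "emeasure (distr M borel e) A = prob {\<omega> \<in> space M. e \<omega> \<in> A \<and> y \<omega> \<in> UNIV}"
      by (subst emeasure_distr) (auto simp: emeasure_eq_measure vimage_def Int_def conj_commute)
    also have "\<dots> = N.prob A"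
      by (subst rect) (auto simp: prob_space)
    finally show "emeasure (distr M borel e) A = emeasure ?N A"
      by (simp add: N.emeasure_eq_measure)
  qed (simp add: setsN)
  interpret Y: prob_space "distr M borel y" by (rule prob_space_distr) simp
  have pair: "?N \<Otimes>\<^sub>M distr M borel y = distr M (borel \<Otimes>\<^sub>M borel) (\<lambda>\<omega>. (e \<omega>, y \<omega>))"
  proof (rule pair_measure_eqI)
    show "sigma_finite_measure ?N" "sigma_finite_measure (distr M borel y)" by unfold_locales
    show "sets (?N \<Otimes>\<^sub>M distr M borel y) = sets (distr M (borel \<Otimes>\<^sub>M borel) (\<lambda>\<omega>. (e \<omega>, y \<omega>)))"
      by (simp add: setsN cong: sets_pair_measure_cong)
    fix A B assume "A \<in> sets ?N" "B \<in> sets (distr M borel y)"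
    then have A[measurable]: "A \<in> sets borel" and B[measurable]: "B \<in> sets borel" by (simp_all add: setsN)
    have "emeasure (distr M (borel \<Otimes>\<^sub>M borel) (\<lambda>\<omega>. (e \<omega>, y \<omega>))) (A \<times> B) =
        prob {\<omega> \<in> space M. e \<omega> \<in> A \<and> y \<omega> \<in> B}"
      by (subst emeasure_distr) (auto simp: emeasure_eq_measure vimage_def Int_def conj_commute intro!: arg_cong[where f = prob])
    moreover have "emeasure (distr M borel y) B = prob {\<omega> \<in> space M. y \<omega> \<in> B}"
      by (subst emeasure_distr) (auto simp: emeasure_eq_measure vimage_def Int_def conj_commute)
    ultimately show "emeasure ?N A * emeasure (distr M borel y) B =
        emeasure (distr M (borel \<Otimes>\<^sub>M borel) (\<lambda>\<omega>. (e \<omega>, y \<omega>))) (A \<times> B)"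
      by (simp add: rect N.emeasure_eq_measure ennreal_mult)
  qed
  show "indep_var borel (\<lambda>\<omega>. h (e \<omega>)) borel (\<lambda>\<omega>. k (y \<omega>))"
    if [measurable]: "h \<in> borel_measurable borel" "k \<in> borel_measurable borel"
    for h :: "real ^ 'p \<Rightarrow> real" and k :: "real \<Rightarrow> real"
  proof -
    have "distr M borel (\<lambda>\<omega>. h (e \<omega>)) = distr (distr M borel e) borel h"
      "distr M borel (\<lambda>\<omega>. k (y \<omega>)) = distr (distr M borel y) borel k"
      by (simp_all add: distr_distr comp_def)
    moreover have "distr (distr M borel e) borel h \<Otimes>\<^sub>M distr (distr M borel y) borel k =
        distr (distr M borel e \<Otimes>\<^sub>M distr M borel y) (borel \<Otimes>\<^sub>M borel) (\<lambda>(v, r). (h v, k r))"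
    proof (rule pair_measure_distr)
      interpret K: prob_space "distr (distr M borel y) borel k"
        by (rule Y.prob_space_distr) simp
      show "sigma_finite_measure (distr (distr M borel y) borel k)" by unfold_locales
    qed simp_all
    moreover have "distr M borel e \<Otimes>\<^sub>M distr M borel y = distr M (borel \<Otimes>\<^sub>M borel) (\<lambda>\<omega>. (e \<omega>, y \<omega>))"
      unfolding e_law by (rule pair)
    ultimately show ?thesis
      unfolding indep_var_distribution_eq by (simp add: distr_distr comp_def)
  qed
  show "distr M (borel \<Otimes>\<^sub>M borel) (\<lambda>\<omega>. (e \<omega>, y \<omega>)) =
      ?N \<Otimes>\<^sub>M distr (measure_pmf (bernoulli_pmf \<alpha>)) borel of_bool"
    unfolding pair[symmetric] ydistr ..
qed

end

section \<open>Asymptotic normality\<close>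

text \<open>Limits ignore finitely many n, whereas measurability is required for all of them and is
  therefore a separate hypothesis. Here it discards the sample sizes below 3.\<close>

lemma converges_in_distribution_eventually_cong:
  assumes "converges_in_distribution M Z' L" and "\<And>n. Z n \<in> borel_measurable M"
    and ev: "\<forall>\<^sub>F n in sequentially. \<forall>\<omega>\<in>space M. Z n \<omega> = Z' n \<omega>"
  shows "converges_in_distribution M Z L"
  unfolding converges_in_distribution_def
proof (intro conjI allI impI)
  fix f :: "'b \<Rightarrow> real" assume "continuous_on UNIV f \<and> bounded (range f)"
  then have lim: "(\<lambda>n. \<integral>\<omega>. f (Z' n \<omega>) \<partial>M) \<longlonglongrightarrow> (\<integral>x. f x \<partial>L)"
    using assms(1) by (simp add: converges_in_distribution_def)
  have "\<forall>\<^sub>F n in sequentially. (\<integral>\<omega>. f (Z' n \<omega>) \<partial>M) = (\<integral>\<omega>. f (Z n \<omega>) \<partial>M)"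
    using ev by eventually_elim (auto intro: Bochner_Integration.integral_cong)
  then show "(\<lambda>n. \<integral>\<omega>. f (Z n \<omega>) \<partial>M) \<longlonglongrightarrow> (\<integral>x. f x \<partial>L)"
    by (rule Lim_transform_eventually[OF lim])
qed (rule assms(2))

lemma continuous_on_stat_of:
  assumes "continuous_on S e" "continuous_on S y"
  shows "continuous_on S (\<lambda>x. stat_of (e x) (y x))"
  unfolding stat_of_def outer_def
  using assms by (intro continuous_intros continuous_on_vec_lambda)

text \<open>The fourth power comes from the outer product; this bound reduces square integrability
  of the statistic to fourth moments of the normal law.\<close>

lemma norm_stat_of_le:
  assumes "y \<in> {0, 1}"
  shows "(norm (stat_of e y))\<^sup>2 \<le> 1 + 2 * (norm e)\<^sup>2 + (norm e) ^ 4"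
proof -
  have "(norm (outer e e))\<^sup>2 = (norm e) ^ 4"
    using power_mult[of "norm e" 2 2] by (simp add: norm_outer power_mult_distrib power2_eq_square)
  then show ?thesis using assms by (auto simp: stat_of_def norm_Pair)
qed

section \<open>Mean and variance of the statistic of one observation\<close>

locale normal_bernoulli_pair = prob_space M for M :: "'a measure" +
  fixes e :: "'a \<Rightarrow> real ^ 'p" and y :: "'a \<Rightarrow> real" and \<alpha> :: real and A V :: "real ^ 'p ^ 'p"
  assumes factor: "A ** transpose A = V"
    and \<alpha>: "0 < \<alpha>" "\<alpha> < 1"
    and e_meas[measurable]: "e \<in> borel_measurable M" and y_meas[measurable]: "y \<in> borel_measurable M"
    and y_binary: "\<And>\<omega>. \<omega> \<in> space M \<Longrightarrow> y \<omega> \<in> {0, 1}"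
    and e_law: "distr M borel e = mv_normal 0 V"
    and y_law: "distr M borel y = distr (measure_pmf (bernoulli_pmf \<alpha>)) borel of_bool"
    and indep: "\<And>(h :: real ^ 'p \<Rightarrow> real) (k :: real \<Rightarrow> real).
      h \<in> borel_measurable borel \<Longrightarrow> k \<in> borel_measurable borel \<Longrightarrow>
      indep_var borel (\<lambda>\<omega>. h (e \<omega>)) borel (\<lambda>\<omega>. k (y \<omega>))"
begin

lemma e_integral:
  fixes h :: "real ^ 'p \<Rightarrow> real"
  assumes [measurable]: "h \<in> borel_measurable borel"
  shows "integrable M (\<lambda>\<omega>. h (e \<omega>)) \<longleftrightarrow> integrable (mv_normal 0 V) h"
    and "expectation (\<lambda>\<omega>. h (e \<omega>)) = integral\<^sup>L (mv_normal 0 V) h"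
  unfolding e_law[symmetric] by (simp_all add: integrable_distr_eq integral_distr)

lemma y_integral:
  fixes k :: "real \<Rightarrow> real"
  assumes [measurable]: "k \<in> borel_measurable borel"
  shows "integrable M (\<lambda>\<omega>. k (y \<omega>))" and "expectation (\<lambda>\<omega>. k (y \<omega>)) = \<alpha> * k 1 + (1 - \<alpha>) * k 0"
proof -
  show "integrable M (\<lambda>\<omega>. k (y \<omega>))"
  proof (rule integrable_const_bound)
    show "AE \<omega> in M. norm (k (y \<omega>)) \<le> max \<bar>k 0\<bar> \<bar>k 1\<bar>"
    proof (rule AE_I2)
      fix \<omega> assume "\<omega> \<in> space M"
      from y_binary[OF this] show "norm (k (y \<omega>)) \<le> max \<bar>k 0\<bar> \<bar>k 1\<bar>" by auto
    qed
  qed simp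
  have "expectation (\<lambda>\<omega>. k (y \<omega>)) = integral\<^sup>L (distr M borel y) k" by (simp add: integral_distr)
  also have "\<dots> = \<alpha> * k 1 + (1 - \<alpha>) * k 0"
    unfolding y_law using \<alpha> by (simp add: integral_distr)
  finally show "expectation (\<lambda>\<omega>. k (y \<omega>)) = \<dots>" .
qed

lemma product_integral:
  fixes h :: "real ^ 'p \<Rightarrow> real" and k :: "real \<Rightarrow> real"
  assumes [measurable]: "h \<in> borel_measurable borel" "k \<in> borel_measurable borel"
    and h: "integrable (mv_normal 0 V) h"
  shows "integrable M (\<lambda>\<omega>. k (y \<omega>) * h (e \<omega>))"
    and "expectation (\<lambda>\<omega>. k (y \<omega>) * h (e \<omega>)) = (\<alpha> * k 1 + (1 - \<alpha>) * k 0) * integral\<^sup>L (mv_normal 0 V) h"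
proof -
  have "indep_var borel (\<lambda>\<omega>. h (e \<omega>)) borel (\<lambda>\<omega>. k (y \<omega>))" by (rule indep) simp_all
  moreover have "integrable M (\<lambda>\<omega>. h (e \<omega>))" using h by (simp add: e_integral)
  moreover have "integrable M (\<lambda>\<omega>. k (y \<omega>))" by (rule y_integral) simp
  ultimately show "integrable M (\<lambda>\<omega>. k (y \<omega>) * h (e \<omega>))"
    "expectation (\<lambda>\<omega>. k (y \<omega>) * h (e \<omega>)) = (\<alpha> * k 1 + (1 - \<alpha>) * k 0) * integral\<^sup>L (mv_normal 0 V) h"
    using indep_var_integrable[of "\<lambda>\<omega>. h (e \<omega>)" "\<lambda>\<omega>. k (y \<omega>)"]
      indep_var_lebesgue_integral[of "\<lambda>\<omega>. h (e \<omega>)" "\<lambda>\<omega>. k (y \<omega>)"]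
    by (simp_all add: mult.commute e_integral y_integral)
qed

lemma borel_measurable_stat: "(\<lambda>\<omega>. stat_of (e \<omega>) (y \<omega>)) \<in> borel_measurable M"
proof -
  have "(\<lambda>p :: (real ^ 'p) \<times> real. stat_of (fst p) (snd p)) \<in> borel_measurable (borel \<Otimes>\<^sub>M borel)"
    unfolding borel_prod
    by (intro borel_measurable_continuous_onI continuous_on_stat_of continuous_intros)
  from measurable_compose[OF _ this, of "\<lambda>\<omega>. (e \<omega>, y \<omega>)" M] show ?thesis by simp
qed

lemma stat_square_integrable: "integrable M (\<lambda>\<omega>. (norm (stat_of (e \<omega>) (y \<omega>)))\<^sup>2)"
proof (rule Bochner_Integration.integrable_bound)
  show "integrable M (\<lambda>\<omega>. 1 + 2 * (norm (e \<omega>))\<^sup>2 + (norm (e \<omega>)) ^ 4)"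
    using e_integral(1)[of "\<lambda>v. (norm v)\<^sup>2"] e_integral(1)[of "\<lambda>v. (norm v) ^ 4"]
      mv_normal_norm_moments[OF factor] by simp
  show "AE \<omega> in M. norm ((norm (stat_of (e \<omega>) (y \<omega>)))\<^sup>2) \<le> norm (1 + 2 * (norm (e \<omega>))\<^sup>2 + (norm (e \<omega>)) ^ 4)"
  proof (rule AE_I2)
    fix \<omega> assume "\<omega> \<in> space M"
    from norm_stat_of_le[OF y_binary[OF this], of "e \<omega>"]
    show "norm ((norm (stat_of (e \<omega>) (y \<omega>)))\<^sup>2) \<le> norm (1 + 2 * (norm (e \<omega>))\<^sup>2 + (norm (e \<omega>)) ^ 4)"
      by simp
  qed
qed (use borel_measurable_stat in measurable)

text \<open>Coordinate functionals commute with the expectation. The two middle blocks vanish by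
  independence, the residual being centred, and the last block is its second moment matrix.\<close>

lemma stat_mean: "expectation (\<lambda>\<omega>. stat_of (e \<omega>) (y \<omega>)) = (\<alpha>, 0, 0, V)"
proof -
  let ?\<xi> = "\<lambda>\<omega>. stat_of (e \<omega>) (y \<omega>)"
  note bs = borel_measurable_stat
  have int: "integrable M ?\<xi>"
  proof (rule Bochner_Integration.integrable_bound[OF _ bs])
    show "integrable M (\<lambda>\<omega>. 1 + (norm (?\<xi> \<omega>))\<^sup>2)" using stat_square_integrable by simp
    show "AE \<omega> in M. norm (?\<xi> \<omega>) \<le> norm (1 + (norm (?\<xi> \<omega>))\<^sup>2)"
      by (intro AE_I2 norm_le_norm_one_plus_square)
  qed
  have lin: "l (expectation ?\<xi>) = expectation (\<lambda>\<omega>. l (?\<xi> \<omega>))" if "bounded_linear l"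
    for l :: "'p stat \<Rightarrow> real"
    by (rule integral_bounded_linear[OF that int, symmetric])
  have zero: "expectation (\<lambda>\<omega>. k (y \<omega>) * (axis i 1 \<bullet> e \<omega>)) = 0"
    if k: "k \<in> borel_measurable borel" for k i
  proof -
    have "expectation (\<lambda>\<omega>. k (y \<omega>) * (axis i 1 \<bullet> e \<omega>)) =
        (\<alpha> * k 1 + (1 - \<alpha>) * k 0) * (\<integral>x. axis i 1 \<bullet> x \<partial>mv_normal 0 V)"
      by (rule product_integral(2)[OF _ k mv_normal_moment_1(1)[OF factor]]) simp
    then show ?thesis unfolding mv_normal_moment_1(2)[OF factor] by simp
  qed
  have "fst (expectation ?\<xi>) = expectation (\<lambda>\<omega>. fst (?\<xi> \<omega>))"
    by (rule lin[OF bounded_linear_fst])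
  also have "\<dots> = expectation (\<lambda>\<omega>. y \<omega>)" by (simp only: stat_of_def fst_conv)
  also have "\<dots> = \<alpha> * 1 + (1 - \<alpha>) * 0" by (rule y_integral(2)) simp
  finally have 1: "fst (expectation ?\<xi>) = \<alpha>" by simp
  have 2: "fst (snd (expectation ?\<xi>)) $ i = 0" for i
  proof -
    have "fst (snd (expectation ?\<xi>)) $ i = expectation (\<lambda>\<omega>. fst (snd (?\<xi> \<omega>)) $ i)"
      by (rule lin[OF bounded_linear_stat_nth(1)])
    also have "\<dots> = expectation (\<lambda>\<omega>. y \<omega> * (axis i 1 \<bullet> e \<omega>))"
      by (simp only: stat_of_def fst_conv snd_conv inner_axis' vector_scaleR_component inner_real_def
          real_scaleR_def mult_1)
    also have "\<dots> = 0" by (rule zero) simp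
    finally show ?thesis .
  qed
  have 3: "fst (snd (snd (expectation ?\<xi>))) $ i = 0" for i
  proof -
    have "fst (snd (snd (expectation ?\<xi>))) $ i = expectation (\<lambda>\<omega>. fst (snd (snd (?\<xi> \<omega>))) $ i)"
      by (rule lin[OF bounded_linear_stat_nth(2)])
    also have "\<dots> = expectation (\<lambda>\<omega>. (1 - y \<omega>) * (axis i 1 \<bullet> e \<omega>))"
      by (simp only: stat_of_def fst_conv snd_conv inner_axis' vector_scaleR_component inner_real_def
          real_scaleR_def mult_1)
    also have "\<dots> = 0" by (rule zero) simp
    finally show ?thesis .
  qed
  have 4: "snd (snd (snd (expectation ?\<xi>))) $ i $ j = V $ i $ j" for i j
  proof -
    have "snd (snd (snd (expectation ?\<xi>))) $ i $ j = expectation (\<lambda>\<omega>. snd (snd (snd (?\<xi> \<omega>))) $ i $ j)"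
      by (rule lin[OF bounded_linear_stat_nth(3)])
    also have "\<dots> = expectation (\<lambda>\<omega>. (axis i 1 \<bullet> e \<omega>) * (axis j 1 \<bullet> e \<omega>))"
      by (simp only: stat_of_def snd_conv inner_axis' outer_nth inner_real_def mult_1)
    also have "\<dots> = (\<integral>x. (axis i 1 \<bullet> x) * (axis j 1 \<bullet> x) \<partial>mv_normal 0 V)"
      by (rule e_integral(2)) simp
    also have "\<dots> = axis i 1 \<bullet> (V *v axis j 1)"
      by (rule mv_normal_cross_moment(2)[OF factor])
    also have "\<dots> = V $ i $ j"
      by (simp add: inner_axis' matrix_vector_mult_basis column_def)
    finally show ?thesis .
  qed
  show ?thesis
    by (intro prod_eqI) (simp_all add: 1 2 3 4 vec_eq_iff)
qed

text \<open>Orthogonality acts twice: it removes the centring term u' V \<theta>, and it factorises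
  the mixed fourth moment. The cross term of the square vanishes because the label weight has mean
  zero.\<close>

lemma score_variance:
  assumes orth: "u \<bullet> (V *v \<theta>) = 0"
  shows "expectation (\<lambda>\<omega>. (u \<bullet> (((1 - y \<omega>) *\<^sub>R e \<omega>) /\<^sub>R (1 - \<alpha>) - (y \<omega> *\<^sub>R e \<omega>) /\<^sub>R \<alpha>
      - (outer (e \<omega>) (e \<omega>) - V) *v \<theta>))\<^sup>2) = (1 / (\<alpha> * (1 - \<alpha>)) + \<theta> \<bullet> (V *v \<theta>)) * (u \<bullet> (V *v u))"
proof -
  define c where "c r = (1 - r) / (1 - \<alpha>) - r / \<alpha>" for r
  have [measurable]: "c \<in> borel_measurable borel" unfolding c_def[abs_def] by measurable
  have cm1: "\<alpha> * c 1 + (1 - \<alpha>) * c 0 = 0" using \<alpha> by (simp add: c_def)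
  have cm2: "\<alpha> * (c 1)\<^sup>2 + (1 - \<alpha>) * (c 0)\<^sup>2 = 1 / (\<alpha> * (1 - \<alpha>))"
  proof -
    have "\<alpha> * (c 1)\<^sup>2 = 1 / \<alpha>" "(1 - \<alpha>) * (c 0)\<^sup>2 = 1 / (1 - \<alpha>)"
      using \<alpha> by (simp_all add: c_def power2_eq_square)
    moreover have "1 / \<alpha> + 1 / (1 - \<alpha>) = 1 / (\<alpha> * (1 - \<alpha>))"
      using add_frac_eq[of \<alpha> "1 - \<alpha>" 1 1] \<alpha> by simp
    ultimately show ?thesis by simp
  qed
  have eq: "(u \<bullet> (((1 - y \<omega>) *\<^sub>R e \<omega>) /\<^sub>R (1 - \<alpha>) - (y \<omega> *\<^sub>R e \<omega>) /\<^sub>R \<alpha> - (outer (e \<omega>) (e \<omega>) - V) *v \<theta>))\<^sup>2 =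
      (c (y \<omega>))\<^sup>2 * (u \<bullet> e \<omega>)\<^sup>2 - 2 * (c (y \<omega>) * ((u \<bullet> e \<omega>)\<^sup>2 * (\<theta> \<bullet> e \<omega>))) + (u \<bullet> e \<omega>)\<^sup>2 * (\<theta> \<bullet> e \<omega>)\<^sup>2" for \<omega>
  proof -
    have "u \<bullet> (((1 - y \<omega>) *\<^sub>R e \<omega>) /\<^sub>R (1 - \<alpha>) - (y \<omega> *\<^sub>R e \<omega>) /\<^sub>R \<alpha> - (outer (e \<omega>) (e \<omega>) - V) *v \<theta>) =
        c (y \<omega>) * (u \<bullet> e \<omega>) - (\<theta> \<bullet> e \<omega>) * (u \<bullet> e \<omega>)"
    proof -
      have "(outer (e \<omega>) (e \<omega>) - V) *v \<theta> = (\<theta> \<bullet> e \<omega>) *\<^sub>R e \<omega> - V *v \<theta>"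
        by (simp add: matrix_vector_mult_diff_rdistrib outer_mult_vec inner_commute)
      then have "u \<bullet> (((1 - y \<omega>) *\<^sub>R e \<omega>) /\<^sub>R (1 - \<alpha>) - (y \<omega> *\<^sub>R e \<omega>) /\<^sub>R \<alpha> - (outer (e \<omega>) (e \<omega>) - V) *v \<theta>) =
          inverse (1 - \<alpha>) * ((1 - y \<omega>) * (u \<bullet> e \<omega>)) - inverse \<alpha> * (y \<omega> * (u \<bullet> e \<omega>)) - (\<theta> \<bullet> e \<omega>) * (u \<bullet> e \<omega>)"
        using orth by (simp only: inner_diff_right inner_scaleR_right diff_0_right)
      also have "\<dots> = c (y \<omega>) * (u \<bullet> e \<omega>) - (\<theta> \<bullet> e \<omega>) * (u \<bullet> e \<omega>)"
        by (simp add: c_def divide_inverse algebra_simps)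
      finally show ?thesis .
    qed
    then show ?thesis by (simp only:) (simp add: power2_eq_square algebra_simps)
  qed
  have sq: "integrable (mv_normal 0 V) (\<lambda>x. (u \<bullet> x)\<^sup>2)" by (rule mv_normal_moment(1)[OF factor])
  have quart: "integrable (mv_normal 0 V) (\<lambda>x. (u \<bullet> x)\<^sup>2 * (\<theta> \<bullet> x)\<^sup>2)"
    by (rule mv_normal_square_product(1)[OF factor])
  \<comment> \<open>Dominated through |s| \<le> 1 + s^2. Only integrability matters: the value of
    this moment gets multiplied by the zero mean of c.\<close>
  have cub: "integrable (mv_normal 0 V) (\<lambda>x. (u \<bullet> x)\<^sup>2 * (\<theta> \<bullet> x))"
  proof (rule Bochner_Integration.integrable_bound)
    show "integrable (mv_normal 0 V) (\<lambda>x. (u \<bullet> x)\<^sup>2 + (u \<bullet> x)\<^sup>2 * (\<theta> \<bullet> x)\<^sup>2)" using sq quart by simp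
    have "\<bar>r\<^sup>2 * s\<bar> \<le> \<bar>r\<^sup>2 + r\<^sup>2 * s\<^sup>2\<bar>" for r s :: real
    proof -
      have "\<bar>s\<bar> \<le> 1 + s\<^sup>2" using sum_squares_bound[of "\<bar>s\<bar>" 1] by simp
      then have "r\<^sup>2 * \<bar>s\<bar> \<le> r\<^sup>2 * (1 + s\<^sup>2)" by (rule mult_left_mono) simp
      then show ?thesis by (simp add: abs_mult algebra_simps)
    qed
    then show "AE x in mv_normal 0 V. norm ((u \<bullet> x)\<^sup>2 * (\<theta> \<bullet> x)) \<le> norm ((u \<bullet> x)\<^sup>2 + (u \<bullet> x)\<^sup>2 * (\<theta> \<bullet> x)\<^sup>2)"
      by simp
  qed (simp add: mv_normal_def)
  have i1: "integrable M (\<lambda>\<omega>. (c (y \<omega>))\<^sup>2 * (u \<bullet> e \<omega>)\<^sup>2)"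
    by (rule product_integral(1)[OF _ _ sq]) measurable
  have e1: "expectation (\<lambda>\<omega>. (c (y \<omega>))\<^sup>2 * (u \<bullet> e \<omega>)\<^sup>2) = 1 / (\<alpha> * (1 - \<alpha>)) * (u \<bullet> (V *v u))"
    unfolding cm2[symmetric] mv_normal_moment_2[OF factor, symmetric]
    by (rule product_integral(2)[OF _ _ sq]) measurable
  have i2: "integrable M (\<lambda>\<omega>. c (y \<omega>) * ((u \<bullet> e \<omega>)\<^sup>2 * (\<theta> \<bullet> e \<omega>)))"
    by (rule product_integral(1)[OF _ _ cub]) measurable
  have "expectation (\<lambda>\<omega>. c (y \<omega>) * ((u \<bullet> e \<omega>)\<^sup>2 * (\<theta> \<bullet> e \<omega>))) =
      (\<alpha> * c 1 + (1 - \<alpha>) * c 0) * (\<integral>x. (u \<bullet> x)\<^sup>2 * (\<theta> \<bullet> x) \<partial>mv_normal 0 V)"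
    by (rule product_integral(2)[OF _ _ cub]) measurable
  then have e2: "expectation (\<lambda>\<omega>. c (y \<omega>) * ((u \<bullet> e \<omega>)\<^sup>2 * (\<theta> \<bullet> e \<omega>))) = 0"
    unfolding cm1 by simp
  have i3: "integrable M (\<lambda>\<omega>. (u \<bullet> e \<omega>)\<^sup>2 * (\<theta> \<bullet> e \<omega>)\<^sup>2)"
    by (rule e_integral(1)[THEN iffD2, OF _ quart]) measurable
  have e3: "expectation (\<lambda>\<omega>. (u \<bullet> e \<omega>)\<^sup>2 * (\<theta> \<bullet> e \<omega>)\<^sup>2) = (u \<bullet> (V *v u)) * (\<theta> \<bullet> (V *v \<theta>))"
    unfolding mv_normal_square_product(2)[OF factor orth, symmetric]
    by (rule e_integral(2)) measurable
  have split: "expectation (\<lambda>\<omega>. f \<omega> - 2 * g \<omega> + h \<omega>) = expectation f - 2 * expectation g + expectation h"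
    if "integrable M f" "integrable M g" "integrable M h" for f g h :: "'a \<Rightarrow> real"
    using that by simp
  show ?thesis
    unfolding eq split[OF i1 i2 i3] e1 e2 e3 by (simp add: distrib_right)
qed

end

theorem theorem1:
  fixes M :: "'a measure"
    and X :: "nat \<Rightarrow> 'a \<Rightarrow> real ^ 'p" and Y :: "nat \<Rightarrow> 'a \<Rightarrow> real"
    and \<alpha>\<^sub>1 \<alpha>\<^sub>2 \<beta> \<tau> :: real
    and \<mu>\<^sub>1 \<mu>\<^sub>2 \<theta> d\<^sub>0 :: "real ^ 'p"
    and \<Sigma> \<Psi>\<^sub>U :: "real ^ 'p ^ 'p"
  assumes "prob_space M"
    and "0 < \<alpha>\<^sub>1" and "\<alpha>\<^sub>1 < 1"
    and "\<mu>\<^sub>1 \<noteq> \<mu>\<^sub>2"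
    and "covariance_matrix \<Sigma>" and "rank \<Sigma> = CARD('p)"
    and "prob_space.indep_vars M (\<lambda>_. borel) (\<lambda>i \<omega>. (X i \<omega>, Y i \<omega>)) UNIV"
    and "\<And>i. two_group_normal_mixture M (X i) (Y i) \<alpha>\<^sub>1 \<mu>\<^sub>1 \<mu>\<^sub>2 \<Sigma>"
    and "\<theta> = matrix_inv \<Sigma> *v (\<mu>\<^sub>2 - \<mu>\<^sub>1)"
    and "\<alpha>\<^sub>2 = 1 - \<alpha>\<^sub>1"
    and "\<beta> = \<alpha>\<^sub>1 * \<alpha>\<^sub>2"
    and "\<tau> = (\<mu>\<^sub>2 - \<mu>\<^sub>1) \<bullet> (matrix_inv \<Sigma> *v (\<mu>\<^sub>2 - \<mu>\<^sub>1))"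
    and "\<Psi>\<^sub>U = ((1 + \<beta> * \<tau>) / ((norm \<theta>)\<^sup>2 * \<beta>)) *\<^sub>R
           ((mat 1 - outer \<theta> \<theta> /\<^sub>R (norm \<theta>)\<^sup>2) ** matrix_inv \<Sigma> **
            (mat 1 - outer \<theta> \<theta> /\<^sub>R (norm \<theta>)\<^sup>2))"
  shows "converges_in_distribution M
           (\<lambda>n \<omega>. sqrt (real n) *\<^sub>R
              (lda_direction d\<^sub>0 n (\<lambda>i. X i \<omega>) (\<lambda>i. Y i \<omega>) - \<theta> /\<^sub>R norm \<theta>))
           (mv_normal 0 \<Psi>\<^sub>U)"
proof -
  interpret prob_space M by fact
  note indepXY = assms(7) and mix = assms(8)
  define \<delta> where "\<delta> = \<mu>\<^sub>2 - \<mu>\<^sub>1"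
  define S where "S = matrix_inv \<Sigma>"
  define P :: "real ^ 'p ^ 'p" where "P = mat 1 - outer \<theta> \<theta> /\<^sub>R (norm \<theta>)\<^sup>2"
  define n\<theta> where "n\<theta> = norm \<theta>"
  have sym\<Sigma>: "transpose \<Sigma> = \<Sigma>" using assms(5) by (simp add: covariance_matrix_def)
  have pd\<Sigma>: "0 < v \<bullet> (\<Sigma> *v v)" if "v \<noteq> 0" for v
    using psd_full_rank_imp_pos_def[OF assms(5,6) that] .
  obtain A :: "real ^ 'p ^ 'p" where A: "A ** transpose A = \<Sigma>"
    using pos_def_factorization[OF sym\<Sigma> pd\<Sigma>] by blast
  have inv: "invertible \<Sigma>"
    using assms(6) by (simp add: invertible_det_nz det_eq_0_rank)
  note \<Sigma>S = matrix_inv_mult_vec[OF inv, folded S_def] and \<Sigma>Sm = matrix_inv_inverse[OF inv, folded S_def]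
  have symS: "transpose S = S"
  proof -
    have "transpose S ** \<Sigma> = mat 1"
      using \<Sigma>Sm(1) by (metis matrix_transpose_mul sym\<Sigma> transpose_mat)
    then have "transpose S ** (\<Sigma> ** S) = S" by (simp add: matrix_mul_assoc)
    then show ?thesis by (simp add: \<Sigma>Sm)
  qed
  have self_adjoint: "a \<bullet> (N *v b) = (N *v a) \<bullet> b" if "transpose N = N" for N :: "real ^ 'p ^ 'p" and a b
    using that by (metis dot_lmul_matrix vector_transpose_matrix)
  have pdS: "0 < v \<bullet> (S *v v)" if "v \<noteq> 0" for v
  proof -
    have "S *v v \<noteq> 0" using \<Sigma>S(2)[of v] that by (metis matrix_vector_mult_0_right)
    from pd\<Sigma>[OF this] show ?thesis by (simp add: \<Sigma>S inner_commute)
  qed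
  obtain R :: "real ^ 'p ^ 'p" where R: "R ** transpose R = S"
    using pos_def_factorization[OF symS pdS] by blast
  have \<theta>: "\<theta> = S *v \<delta>" by (simp add: assms(9) S_def \<delta>_def)
  have \<Sigma>\<theta>: "\<Sigma> *v \<theta> = \<delta>" by (simp add: \<theta> \<Sigma>S)
  have "\<delta> \<noteq> 0" using assms(4) by (simp add: \<delta>_def)
  then have \<theta>0: "\<theta> \<noteq> 0" using \<Sigma>\<theta> by auto
  then have n\<theta>: "n\<theta> > 0" by (simp add: n\<theta>_def)
  have \<tau>: "\<tau> = \<theta> \<bullet> (\<Sigma> *v \<theta>)"
    by (simp add: assms(12) \<Sigma>\<theta> \<theta>[unfolded S_def, symmetric] \<delta>_def[symmetric] inner_commute)
  have \<tau>0: "0 < \<tau>" using pd\<Sigma>[OF \<theta>0] by (simp add: \<tau>)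
  have \<beta>: "\<beta> = \<alpha>\<^sub>1 * (1 - \<alpha>\<^sub>1)" "\<beta> > 0" using assms(2,3,10,11) by auto
  have symP: "transpose P = P"
    by (simp add: P_def outer_def transpose_def mat_def vec_eq_iff mult.commute eq_commute)
  have P\<theta>: "P *v \<theta> = 0"
    using \<theta>0 by (simp add: P_def matrix_vector_mult_diff_rdistrib outer_mult_vec
        scaleR_matrix_vector_assoc[symmetric] power2_norm_eq_inner)
  define c where "c = (1 + \<beta> * \<tau>) / (n\<theta>\<^sup>2 * \<beta>)"
  have c: "0 < c" using \<beta>(2) \<tau>0 n\<theta> by (simp add: c_def add_pos_pos)
  have \<Psi>: "\<Psi>\<^sub>U = c *\<^sub>R (P ** S ** P)"
    by (simp add: assms(13) c_def P_def S_def n\<theta>_def)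
  \<comment> \<open>With R R' equal to the inverse of \<open>\<Sigma>\<close> and P symmetric, (P R)
    (P R)' = P S P; the scalar enters as \<open>sqrt c\<close>.\<close>
  define F where "F = sqrt c *\<^sub>R (P ** R)"
  have F: "F ** transpose F = \<Psi>\<^sub>U"
  proof -
    have "(P ** R) ** transpose (P ** R) = P ** (R ** transpose R) ** P"
      by (simp add: matrix_transpose_mul symP matrix_mul_assoc)
    moreover have "transpose F = sqrt c *\<^sub>R transpose (P ** R)"
      by (simp add: F_def transpose_def vec_eq_iff)
    moreover have "(sqrt c *\<^sub>R N) ** (sqrt c *\<^sub>R N') = c *\<^sub>R (N ** N')" for N N' :: "real ^ 'p ^ 'p"
      using c by (simp add: matrix_scalar_ac scalar_matrix_assoc)
    ultimately show ?thesis by (simp only: F_def \<Psi> R)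
  qed
  define e where "e i \<omega> = residual \<mu>\<^sub>1 \<mu>\<^sub>2 (X i \<omega>) (Y i \<omega>)" for i \<omega>
  define \<xi> where "\<xi> i \<omega> = stat_of (e i \<omega>) (Y i \<omega>)" for i \<omega>
  note law = two_group_residual_law[OF mix, folded e_def]
  have Y01: "Y i \<omega> \<in> {0, 1}" if "\<omega> \<in> space M" for i \<omega>
    using mix[of i] that by (simp add: two_group_normal_mixture_def)
  have pair: "normal_bernoulli_pair M (e i) (Y i) \<alpha>\<^sub>1 A \<Sigma>" for i
  proof unfold_locales
    show "distr M borel (Y i) = distr (measure_pmf (bernoulli_pmf \<alpha>\<^sub>1)) borel of_bool"
      using mix[of i] by (simp add: two_group_normal_mixture_def)
  qed (use A assms(2,3) law Y01 in auto)
  interpret Z: normal_bernoulli_pair M "e 0" "Y 0" \<alpha>\<^sub>1 A \<Sigma> by (rule pair)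
  have stat_meas: "(\<lambda>p :: (real ^ 'p) \<times> real. stat_of (fst p) (snd p)) \<in> borel_measurable (borel \<Otimes>\<^sub>M borel)"
    unfolding borel_prod
    by (intro borel_measurable_continuous_onI continuous_on_stat_of continuous_intros)
  have \<xi>_indep: "indep_vars (\<lambda>_. borel) \<xi> UNIV"
  proof -
    have "indep_vars (\<lambda>_. borel)
        (\<lambda>i \<omega>. (\<lambda>p. stat_of (residual \<mu>\<^sub>1 \<mu>\<^sub>2 (fst p) (snd p)) (snd p)) (X i \<omega>, Y i \<omega>)) UNIV"
      unfolding residual_def
      by (rule indep_vars_compose2[OF indepXY])
         (intro borel_measurable_continuous_onI continuous_on_stat_of continuous_intros)
    then show ?thesis by (simp add: \<xi>_def[abs_def] e_def)
  qed
  \<comment> \<open>The model determines the joint law of residual and label, and each \<xi> i is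
    the same measurable image of that pair; so all of them share one law.\<close>
  have \<xi>_distr: "distr M borel (\<xi> i) =
      distr (mv_normal 0 \<Sigma> \<Otimes>\<^sub>M distr (measure_pmf (bernoulli_pmf \<alpha>\<^sub>1)) borel of_bool) borel
        (\<lambda>p. stat_of (fst p) (snd p))" for i
    unfolding law(5)[of i, symmetric]
    by (subst distr_distr[OF stat_meas])
       (use law(1,2) in \<open>auto simp: comp_def \<xi>_def[abs_def]\<close>)
  define D where "D = (\<lambda>(da :: real, db, dc, dQ). (P *v
      (S *v (dc /\<^sub>R (1 - \<alpha>\<^sub>1) - db /\<^sub>R \<alpha>\<^sub>1 - dQ *v \<theta>))) /\<^sub>R norm \<theta>)"
  note G = has_derivative_stat_direction[OF assms(2,3) inv \<theta>[unfolded S_def] \<theta>0, of d\<^sub>0,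
      folded S_def, folded P_def, folded D_def]
  have var: "expectation (\<lambda>\<omega>. (t \<bullet> D (\<xi> 0 \<omega> - (\<alpha>\<^sub>1, 0, 0, \<Sigma>)))\<^sup>2) = t \<bullet> (\<Psi>\<^sub>U *v t)" for t
  proof -
    \<comment> \<open>The adjoint of D moved onto t, using the symmetry of P and S. Since S inverts
      \<open>\<Sigma>\<close>, u' \<Sigma> \<theta> is a multiple of (P t)' \<theta> = t' P \<theta>
      = 0.\<close>
    define u where "u = (S *v (P *v t)) /\<^sub>R n\<theta>"
    have orth: "u \<bullet> (\<Sigma> *v \<theta>) = 0"
    proof -
      have "u \<bullet> (\<Sigma> *v \<theta>) = ((P *v t) \<bullet> (S *v (\<Sigma> *v \<theta>))) / n\<theta>"
        by (simp add: u_def self_adjoint[OF symS] divide_inverse_commute)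
      also have "\<dots> = 0"
        using self_adjoint[OF symP, of t \<theta>] P\<theta> by (simp add: \<Sigma>S)
      finally show ?thesis .
    qed
    have tD: "t \<bullet> D (\<xi> 0 \<omega> - (\<alpha>\<^sub>1, 0, 0, \<Sigma>)) = u \<bullet> (((1 - Y 0 \<omega>) *\<^sub>R e 0 \<omega>) /\<^sub>R (1 - \<alpha>\<^sub>1) - (Y 0 \<omega> *\<^sub>R e 0 \<omega>) /\<^sub>R \<alpha>\<^sub>1
        - (outer (e 0 \<omega>) (e 0 \<omega>) - \<Sigma>) *v \<theta>)" for \<omega>
      by (simp only: D_def \<xi>_def stat_of_def minus_prod_def fst_conv snd_conv prod.case diff_0_right
          inner_scaleR_right self_adjoint[OF symP] self_adjoint[OF symS] u_def inner_scaleR_left n\<theta>_def)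
    have uu: "u \<bullet> (\<Sigma> *v u) = ((P *v t) \<bullet> (S *v (P *v t))) / n\<theta>\<^sup>2"
      by (simp add: u_def matrix_vector_mult_scaleR \<Sigma>S inner_commute power2_eq_square divide_inverse)
    have "t \<bullet> (\<Psi>\<^sub>U *v t) = c * ((P *v t) \<bullet> (S *v (P *v t)))"
      by (simp add: \<Psi> scaleR_matrix_vector_assoc[symmetric] matrix_vector_mul_assoc[symmetric]
          self_adjoint[OF symP])
    \<comment> \<open>The factor |\<theta>|^2 in the denominator of c cancels against the
      normalisation of u, which leaves (1 + \<beta> \<tau>) / \<beta> = 1 / \<beta> +
      \<tau>.\<close>
    also have "\<dots> = (1 / \<beta> + \<tau>) * (u \<bullet> (\<Sigma> *v u))"
      using \<beta>(2) n\<theta> by (simp add: c_def uu field_simps)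
    also have "\<dots> = expectation (\<lambda>\<omega>. (t \<bullet> D (\<xi> 0 \<omega> - (\<alpha>\<^sub>1, 0, 0, \<Sigma>)))\<^sup>2)"
      unfolding tD Z.score_variance[OF orth] \<beta>(1) \<tau> ..
    finally show ?thesis ..
  qed
  let ?Z' = "\<lambda>n \<omega>. sqrt n *\<^sub>R (stat_direction d\<^sub>0 \<delta> ((\<Sum>i<n. \<xi> i \<omega>) /\<^sub>R real n) - \<theta> /\<^sub>R norm \<theta>)"
  have lim: "converges_in_distribution M ?Z' (mv_normal 0 \<Psi>\<^sub>U)"
    using delta_method_clt[OF \<xi>_indep \<xi>_distr Z.stat_square_integrable[folded \<xi>_def]
        Z.stat_mean[folded \<xi>_def] G(1) borel_measurable_stat_direction F var]
    unfolding G(2) .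
  \<comment> \<open>An identity at every point of the space. It transfers measurability as well as
    the limit from \<open>stat_direction\<close>, so \<open>matrix_inv\<close> itself never has to
    be shown measurable.\<close>
  have eq: "lda_direction d\<^sub>0 n (\<lambda>i. X i \<omega>) (\<lambda>i. Y i \<omega>) =
      (if n < 3 then d\<^sub>0 else stat_direction d\<^sub>0 \<delta> ((\<Sum>i<n. \<xi> i \<omega>) /\<^sub>R real n))"
    if "\<omega> \<in> space M" for n \<omega>
    using lda_direction_small_sample[of n "\<lambda>i. Y i \<omega>" d\<^sub>0 "\<lambda>i. X i \<omega>"]
      lda_direction_eq_stat_direction[of n "\<lambda>i. Y i \<omega>" d\<^sub>0 "\<lambda>i. X i \<omega>" \<mu>\<^sub>2 \<mu>\<^sub>1] Y01[OF that]
    by (simp add: \<xi>_def e_def \<delta>_def)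
  let ?Z = "\<lambda>n \<omega>. sqrt (real n) *\<^sub>R
      (lda_direction d\<^sub>0 n (\<lambda>i. X i \<omega>) (\<lambda>i. Y i \<omega>) - \<theta> /\<^sub>R norm \<theta>)"
  show ?thesis
  proof (rule converges_in_distribution_eventually_cong[OF lim])
    show "?Z n \<in> borel_measurable M" for n
    proof (cases "n < 3")
      case True
      then have "?Z n \<in> borel_measurable M \<longleftrightarrow> (\<lambda>\<omega>. sqrt (real n) *\<^sub>R (d\<^sub>0 - \<theta> /\<^sub>R norm \<theta>)) \<in> borel_measurable M"
        by (intro measurable_cong) (simp add: eq)
      then show ?thesis by simp
    next
      case False
      then have "?Z n \<in> borel_measurable M \<longleftrightarrow> ?Z' n \<in> borel_measurable M"
        by (intro measurable_cong) (simp add: eq)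
      then show ?thesis using lim by (simp add: converges_in_distribution_def)
    qed
    show "\<forall>\<^sub>F n in sequentially. \<forall>\<omega>\<in>space M. ?Z n \<omega> = ?Z' n \<omega>"
      using eventually_ge_at_top[of 3] by eventually_elim (simp add: eq)
  qed
qed

end
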